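(* Let $A$ be an $S_n$-matrix. Then the following conditions are equivalent: (a) $W(A)$ is a circular disc centered at the origin. (b) $W(A\otimes A)$ is a circular disc centered at the origin. (c) $A$ is unitarily similar to $J_n$.
   Context: An $n$-by-$n$ complex matrix $A$ is an $S_n$-matrix (of class $S_n$) if $\|A\|\le 1$ (operator norm), all eigenvalues of $A$ lie in the open unit disc $\{z\in\mathbb{C}:|z|<1\}$, and $\operatorname{rank}(I_n-A^*A)=1$. The numerical range of an $N$-by-$N$ matrix $M$ is $W(M)=\{\langle Mx,x\rangle:x\in\mathbb{C}^N,\|x\|=1\}$. $A\otimes A$ is the tensor (Kronecker) product of $A$ with itself, an $n^2$-by-$n^2$ matrix. A circular disc is closed, and radius $0$ (a single point) is permitted. $J_n$ is the $n$-by-$n$ nilpotent Jordan block, with $1$'s on the first superdiagonal and $0$'s elsewhere. *)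

theory Defs
  imports
    "Jordan_Normal_Form.Schur_Decomposition"
    "Jordan_Normal_Form.Jordan_Normal_Form"
    "Jordan_Normal_Form.DL_Rank"
    "HOL-Analysis.Elementary_Metric_Spaces"
begin

definition cvec_norm :: "complex vec \<Rightarrow> real" where
  "cvec_norm v = sqrt (Re (v \<bullet>c v))"

text \<open>The unit ball rather than the unit sphere is used, so that the supremum is over a nonempty
  (and bounded) set also for matrices without columns.\<close>

definition cmat_opnorm :: "complex mat \<Rightarrow> real" where
  "cmat_opnorm A = (SUP x \<in> {x \<in> carrier_vec (dim_col A). cvec_norm x \<le> 1}. cvec_norm (A *\<^sub>v x))"

text \<open>No condition \<open>n \<ge> 1\<close> is needed: the rank condition fails for \<open>n = 0\<close>.\<close>

definition S_matrix :: "nat \<Rightarrow> complex mat \<Rightarrow> bool" where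
  "S_matrix n A \<longleftrightarrow>
     A \<in> carrier_mat n n \<and>
     cmat_opnorm A \<le> 1 \<and>
     (\<forall>z. eigenvalue A z \<longrightarrow> cmod z < 1) \<and>
     vec_space.rank n (1\<^sub>m n - mat_adjoint A * A) = 1"

text \<open>The form \<open>v \<bullet>c w\<close> is conjugate-linear in its second argument.\<close>

definition numerical_range :: "complex mat \<Rightarrow> complex set" where
  "numerical_range M =
     {(M *\<^sub>v x) \<bullet>c x | x. x \<in> carrier_vec (dim_col M) \<and> cvec_norm x = 1}"

text \<open>Block \<open>(i, j)\<close> of the Kronecker product is \<open>A $$ (i, j)\<close> times \<open>B\<close>.\<close>

definition kronecker_mat :: "complex mat \<Rightarrow> complex mat \<Rightarrow> complex mat" where
  "kronecker_mat A B =
     mat (dim_row A * dim_row B) (dim_col A * dim_col B)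
       (\<lambda>(i, j). A $$ (i div dim_row B, j div dim_col B) * B $$ (i mod dim_row B, j mod dim_col B))"

text \<open>The predicate \<open>similar_mat_wit A B U V\<close> includes \<open>U * V = V * U = 1\<close>, so with
  \<open>V\<close> the adjoint of \<open>U\<close> it says that \<open>U\<close> is unitary.\<close>

definition unitarily_similar :: "complex mat \<Rightarrow> complex mat \<Rightarrow> bool" where
  "unitarily_similar A B \<longleftrightarrow> (\<exists>U. similar_mat_wit A B U (mat_adjoint U))"

definition origin_disc :: "complex set \<Rightarrow> bool" where
  "origin_disc S \<longleftrightarrow> (\<exists>r\<ge>0. S = cball 0 r)"

end

theory Submission
  imports Defs "HOL-Analysis.L2_Norm" "Jordan_Normal_Form.Spectral_Radius"
begin

text \<open>Let \<open>M\<close> be \<open>A\<close> or \<open>A \<otimes> A\<close>. If \<open>W(M)\<close> is the disc of radius \<open>\<rho>\<close> about the origin, then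
  \<open>M - 2\<rho>t + t\<^sup>2M\<^sup>*\<close> is singular for all \<open>t\<close> on the unit circle, hence for all complex \<open>t\<close>, and the limit
  \<open>t \<rightarrow> 0\<close> carries information about the nilpotent part of \<open>M\<close>. Choose an orthonormal basis in which \<open>A\<close> is
  upper triangular with its \<open>m\<close> zero eigenvalues first. The rank condition then forces \<open>A\<^sup>*A = diag(0, 1, \<dots>, 1)\<close>
  as soon as \<open>m > 0\<close>, so that the first \<open>m\<close> columns are those of \<open>J\<^sub>m\<close> up to phases and the other columns live in the
  rows from \<open>m\<close> on. In the limit one finds a vector \<open>y \<noteq> 0\<close> in the kernel of \<open>M\<^sup>m\<close> with
  \<open>(N + N\<^sup>*) y = 2\<rho>y\<close>, where \<open>N\<close>, the restriction of \<open>M\<close> to this kernel, is a contraction shifting \<open>m\<close> layers. Hence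
  \<open>\<rho> \<le> cos (\<pi>/(m+1))\<close>. On the other hand some unit vector \<open>x\<close> has all of \<open>x, Ax, \<dots>, A\<^bsup>n-1\<^esup>x\<close> of norm \<open>1\<close>, which
  yields \<open>\<rho> \<ge> cos (\<pi>/(n+1))\<close>, for \<open>A \<otimes> A\<close> by using \<open>x \<otimes> x\<close>. Thus \<open>m = n\<close> and \<open>A\<close> is unitarily similar to \<open>J\<^sub>n\<close>.\<close>

subsection \<open>Vectors and forms in coordinates\<close>

text \<open>Vectors are functions on \<open>nat\<close> of which only the values below
  \<open>N\<close> matter, so that no carrier conditions arise. The form is conjugate-linear in its
  second argument, as in \<open>numerical_range\<close>.\<close>

definition ip :: "nat \<Rightarrow> (nat \<Rightarrow> complex) \<Rightarrow> (nat \<Rightarrow> complex) \<Rightarrow> complex" where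
  "ip N x y = (\<Sum>i<N. x i * cnj (y i))"

definition app :: "nat \<Rightarrow> (nat \<Rightarrow> nat \<Rightarrow> complex) \<Rightarrow> (nat \<Rightarrow> complex) \<Rightarrow> nat \<Rightarrow> complex" where
  "app N M x i = (\<Sum>j<N. M i j * x j)"

definition sq :: "nat \<Rightarrow> (nat \<Rightarrow> complex) \<Rightarrow> real" where
  "sq N x = (\<Sum>i<N. (cmod (x i))\<^sup>2)"

lemma ip_self: "ip N x x = of_real (sq N x)"
  by (simp add: ip_def sq_def complex_norm_square[symmetric] del: of_real_power)

lemma sq_nonneg: "0 \<le> sq N x"
  by (simp add: sq_def sum_nonneg)

lemma sq_eq_0_iff: "sq N x = 0 \<longleftrightarrow> (\<forall>i<N. x i = 0)"
  by (auto simp: sq_def sum_nonneg_eq_0_iff)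

lemma sq_pos: "i < N \<Longrightarrow> x i \<noteq> 0 \<Longrightarrow> 0 < sq N x"
  using sq_eq_0_iff[of N x] sq_nonneg[of N x] by fastforce

lemma sq_scale: "sq N (\<lambda>i. c * x i) = (cmod c)\<^sup>2 * sq N x"
  by (simp add: sq_def norm_mult power_mult_distrib sum_distrib_left)

lemma app_scale: "app N M (\<lambda>i. c * x i) = (\<lambda>i. c * app N M x i)"
  by (simp add: fun_eq_iff app_def sum_distrib_left algebra_simps)

lemma app_cong: "(\<And>j. j < N \<Longrightarrow> x j = y j) \<Longrightarrow> app N M x i = app N M y i"
  by (simp add: app_def)

lemma app_sum: "app N M (\<lambda>j. \<Sum>k\<in>K. x k j) i = (\<Sum>k\<in>K. app N M (x k) i)"
  unfolding app_def sum_distrib_left by (rule sum.swap)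

lemma ip_cong:
  "(\<And>i. i < N \<Longrightarrow> x i = x' i) \<Longrightarrow> (\<And>i. i < N \<Longrightarrow> y i = y' i) \<Longrightarrow> ip N x y = ip N x' y'"
  by (simp add: ip_def)

lemma sq_cong: "(\<And>i. i < N \<Longrightarrow> x i = y i) \<Longrightarrow> sq N x = sq N y"
  by (simp add: sq_def)

lemma ip_bound: "cmod (ip N x y) \<le> sqrt (sq N x) * sqrt (sq N y)"
proof -
  have "cmod (ip N x y) \<le> (\<Sum>i<N. \<bar>cmod (x i)\<bar> * \<bar>cmod (y i)\<bar>)"
    unfolding ip_def by (rule order_trans[OF norm_sum]) (simp add: norm_mult)
  also have "\<dots> \<le> L2_set (\<lambda>i. cmod (x i)) {..<N} * L2_set (\<lambda>i. cmod (y i)) {..<N}"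
    by (rule L2_set_mult_ineq)
  finally show ?thesis by (simp add: L2_set_def sq_def)
qed

lemma ip_app_adjoint: "ip N (app N M x) y = ip N x (app N (\<lambda>i j. cnj (M j i)) y)"
  unfolding ip_def app_def sum_distrib_right sum_distrib_left cnj_sum
  by (subst sum.swap) (simp add: algebra_simps)

lemma ip_sum_sum:
  "ip N (\<lambda>i. \<Sum>k\<in>K. a k i) (\<lambda>i. \<Sum>l\<in>L. b l i) = (\<Sum>k\<in>K. \<Sum>l\<in>L. ip N (a k) (b l))"
proof -
  have "ip N (\<lambda>i. \<Sum>k\<in>K. a k i) (\<lambda>i. \<Sum>l\<in>L. b l i) = (\<Sum>i<N. \<Sum>k\<in>K. \<Sum>l\<in>L. a k i * cnj (b l i))"
    by (simp add: ip_def sum_product)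
  also have "\<dots> = (\<Sum>k\<in>K. \<Sum>i<N. \<Sum>l\<in>L. a k i * cnj (b l i))"
    by (rule sum.swap)
  also have "\<dots> = (\<Sum>k\<in>K. \<Sum>l\<in>L. \<Sum>i<N. a k i * cnj (b l i))"
    by (intro sum.cong refl sum.swap)
  finally show ?thesis by (simp add: ip_def)
qed

section \<open>Sine weights and sums of products of adjacent terms\<close>

lemma sin_recurrence:
  fixes \<theta> :: real
  shows "sin (k * \<theta>) + sin ((k + 2) * \<theta>) = 2 * cos \<theta> * sin ((k + 1) * \<theta>)"
proof -
  have "sin ((k + 1) * \<theta> - \<theta>) + sin ((k + 1) * \<theta> + \<theta>) = 2 * cos \<theta> * sin ((k + 1) * \<theta>)"
    by (simp only: sin_add sin_diff) (simp add: algebra_simps)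
  then show ?thesis by (simp add: algebra_simps)
qed

lemma sin_grid_pos:
  assumes "0 < k" "k \<le> m"
  shows "0 < sin (real k * (pi / real (m + 1)))"
proof (rule sin_gt_zero)
  show "0 < real k * (pi / real (m + 1))" using assms by simp
  have "real k * pi < real (m + 1) * pi" using assms by (intro mult_strict_right_mono) auto
  then show "real k * (pi / real (m + 1)) < pi" by (simp add: field_simps)
qed

text \<open>The weights are the Perron eigenvector \<open>sin (k\<theta>)\<close> of the path with \<open>m\<close> vertices.\<close>

lemma sum_adjacent_le_cos:
  fixes a :: "nat \<Rightarrow> real"
  assumes am: "a m = 0"
  shows "(\<Sum>k<m. a k * a (Suc k)) \<le> cos (pi / real (m + 1)) * (\<Sum>k<m. (a k)\<^sup>2)"
proof -
  define \<theta> where "\<theta> = pi / real (m + 1)"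
  define s where "s k = sin (real k * \<theta>)" for k
  have pos: "0 < s k" if "0 < k" "k \<le> m" for k
    using sin_grid_pos[OF that] by (simp add: s_def \<theta>_def)
  have s0: "s 0 = 0" by (simp add: s_def)
  have sm: "s (Suc m) = 0" by (simp add: s_def \<theta>_def)
  have rec: "s k + s (Suc (Suc k)) = 2 * cos \<theta> * s (Suc k)" for k
    using sin_recurrence[of "real k" \<theta>] by (simp add: s_def add.commute add.left_commute)
  \<comment> \<open>Weighted AM-GM. The ratio of consecutive weights is chosen so that, after the
    second sum is shifted by one, the coefficient of the square of \<open>a k\<close> becomes
    \<open>(s k + s (Suc (Suc k))) / s (Suc k)\<close>, which is
    \<open>2 * cos \<theta>\<close>.\<close>
  have step: "2 * (a k * a (Suc k)) \<le>
      s (Suc (Suc k)) / s (Suc k) * (a k)\<^sup>2 + s (Suc k) / s (Suc (Suc k)) * (a (Suc k))\<^sup>2"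
    if k: "k < m" for k
  proof (cases "Suc k = m")
    case True
    \<comment> \<open>Here \<open>s (Suc m)\<close> is 0, and the quotient that it would divide is
      multiplied by \<open>a m = 0\<close>, so both sides vanish.\<close>
    then show ?thesis using am sm by simp
  next
    case False
    then have p: "0 < s (Suc k)" "0 < s (Suc (Suc k))" using pos k by auto
    define \<tau> where "\<tau> = s (Suc (Suc k)) / s (Suc k)"
    have \<tau>: "0 < \<tau>" using p by (simp add: \<tau>_def)
    have "0 \<le> (\<tau> * a k - a (Suc k))\<^sup>2 / \<tau>" using \<tau> by simp
    also have "\<dots> = \<tau> * (a k)\<^sup>2 + (a (Suc k))\<^sup>2 / \<tau> - 2 * (a k * a (Suc k))"
      using \<tau> by (simp add: field_simps power2_eq_square)
    finally show ?thesis using p by (simp add: \<tau>_def mult.commute)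
  qed
  have "2 * (\<Sum>k<m. a k * a (Suc k)) \<le> (\<Sum>k<m. s (Suc (Suc k)) / s (Suc k) * (a k)\<^sup>2)
      + (\<Sum>k<m. s (Suc k) / s (Suc (Suc k)) * (a (Suc k))\<^sup>2)"
    unfolding sum_distrib_left sum.distrib[symmetric] by (rule sum_mono) (use step in auto)
  \<comment> \<open>The shift of the index costs nothing: the new term at 0 vanishes by
    \<open>s 0 = 0\<close>, the one at \<open>m\<close> by \<open>a m = 0\<close>.\<close>
  also have "(\<Sum>k<m. s (Suc k) / s (Suc (Suc k)) * (a (Suc k))\<^sup>2) =
      (\<Sum>k<m. s k / s (Suc k) * (a k)\<^sup>2)"
  proof -
    have "(\<Sum>k<Suc m. s k / s (Suc k) * (a k)\<^sup>2) =
      s 0 / s (Suc 0) * (a 0)\<^sup>2 + (\<Sum>k<m. s (Suc k) / s (Suc (Suc k)) * (a (Suc k))\<^sup>2)"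
      by (rule sum.lessThan_Suc_shift)
    then show ?thesis using s0 am by simp
  qed
  also have "(\<Sum>k<m. s (Suc (Suc k)) / s (Suc k) * (a k)\<^sup>2) + (\<Sum>k<m. s k / s (Suc k) * (a k)\<^sup>2)
      = (\<Sum>k<m. 2 * cos \<theta> * (a k)\<^sup>2)"
    unfolding sum.distrib[symmetric]
  proof (rule sum.cong)
    fix k assume "k \<in> {..<m}"
    then have "0 < s (Suc k)" using pos by auto
    then have "(s k + s (Suc (Suc k))) / s (Suc k) = 2 * cos \<theta>" unfolding rec by simp
    then show "s (Suc (Suc k)) / s (Suc k) * (a k)\<^sup>2 + s k / s (Suc k) * (a k)\<^sup>2 = 2 * cos \<theta> * (a k)\<^sup>2"
      by (metis (no_types, opaque_lifting) add.commute add_divide_distrib distrib_right)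
  qed simp
  finally show ?thesis by (simp add: \<theta>_def sum_distrib_left[symmetric])
qed

text \<open>Cut y into layers \<open>Y k\<close> according to the grade \<open>g\<close>. Row i only
  sees the layer one above its own, so the form is the sum of the pairings of M
  \<open>Y (Suc k)\<close> with \<open>Y k\<close>. Cauchy-Schwarz and contractivity bound it by
  products of adjacent layer norms; layer \<open>m\<close> is empty, which is the boundary condition
  of \<open>sum_adjacent_le_cos\<close>.\<close>

lemma block_shift_bound:
  assumes contr: "\<And>y. sq N (app N M y) \<le> sq N y"
    and shift: "\<And>i j. i < N \<Longrightarrow> j < N \<Longrightarrow> M i j \<noteq> 0 \<Longrightarrow> g j < m \<Longrightarrow> g j = Suc (g i)"
    and supp: "\<And>i. i < N \<Longrightarrow> y i \<noteq> 0 \<Longrightarrow> g i < m"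
  shows "cmod (ip N (app N M y) y) \<le> cos (pi / real (m + 1)) * sq N y"
proof -
  define Y where "Y k = (\<lambda>i. if g i = k then y i else 0)" for k
  define a where "a k = sqrt (sq N (Y k))" for k
  have am: "a m = 0" using supp by (fastforce simp: a_def sq_def Y_def intro!: sum.neutral)
  have "ip N (app N M y) y = (\<Sum>i<N. \<Sum>k<m. app N M (Y (Suc k)) i * cnj (Y k i))"
    unfolding ip_def
  proof (rule sum.cong)
    fix i assume "i \<in> {..<N}"
    then have i: "i < N" by simp
    have "app N M y i * cnj (y i) = app N M (Y (Suc (g i))) i * cnj (y i)"
    proof -
      have "app N M y i = app N M (Y (Suc (g i))) i"
        unfolding app_def
      proof (rule sum.cong)
        fix j assume "j \<in> {..<N}"
        then show "M i j * y j = M i j * Y (Suc (g i)) j"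
          using shift[OF i, of j] supp[of j] by (auto simp: Y_def)
      qed simp
      then show ?thesis by simp
    qed
    also have "\<dots> = (\<Sum>k<m. if k = g i then app N M (Y (Suc k)) i * cnj (y i) else 0)"
      using supp[OF i] by (cases "g i < m") (auto simp: sum.delta)
    also have "\<dots> = (\<Sum>k<m. app N M (Y (Suc k)) i * cnj (Y k i))"
      by (rule sum.cong) (auto simp: Y_def)
    finally show "app N M y i * cnj (y i) = (\<Sum>k<m. app N M (Y (Suc k)) i * cnj (Y k i))" .
  qed simp
  also have "\<dots> = (\<Sum>k<m. ip N (app N M (Y (Suc k))) (Y k))"
    unfolding ip_def by (rule sum.swap)
  finally have "cmod (ip N (app N M y) y) \<le> (\<Sum>k<m. cmod (ip N (app N M (Y (Suc k))) (Y k)))"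
    by (simp add: norm_sum)
  also have "\<dots> \<le> (\<Sum>k<m. a k * a (Suc k))"
  proof (rule sum_mono)
    fix k
    have "cmod (ip N (app N M (Y (Suc k))) (Y k)) \<le> sqrt (sq N (app N M (Y (Suc k)))) * a k"
      unfolding a_def by (rule ip_bound)
    also have "\<dots> \<le> a (Suc k) * a k"
      unfolding a_def using contr by (intro mult_right_mono) (auto simp: sq_nonneg)
    finally show "cmod (ip N (app N M (Y (Suc k))) (Y k)) \<le> a k * a (Suc k)" by (simp add: mult.commute)
  qed
  also have "\<dots> \<le> cos (pi / real (m + 1)) * (\<Sum>k<m. (a k)\<^sup>2)"
    by (rule sum_adjacent_le_cos) (rule am)
  also have "(\<Sum>k<m. (a k)\<^sup>2) = sq N y"
  proof -
    have "(\<Sum>k<m. (a k)\<^sup>2) = (\<Sum>k<m. sq N (Y k))" by (simp add: a_def sq_nonneg)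
    also have "\<dots> = (\<Sum>i<N. \<Sum>k<m. (cmod (Y k i))\<^sup>2)" unfolding sq_def by (rule sum.swap)
    also have "\<dots> = sq N y" unfolding sq_def
    proof (rule sum.cong)
      fix i assume "i \<in> {..<N}"
      have "(\<Sum>k<m. (cmod (Y k i))\<^sup>2) = (\<Sum>k<m. if k = g i then (cmod (y i))\<^sup>2 else 0)"
        by (rule sum.cong) (auto simp: Y_def)
      then show "(\<Sum>k<m. (cmod (Y k i))\<^sup>2) = (cmod (y i))\<^sup>2"
        using supp[of i] \<open>i \<in> {..<N}\<close> by (cases "g i < m") (auto simp: sum.delta)
    qed simp
    finally show ?thesis .
  qed
  finally show ?thesis .
qed

text \<open>Makes singularity accessible to determinants: in \<open>graded_kernel\<close> as a
  polynomial in a parameter, in \<open>isometric_chain\<close> through invariance under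
  transposition.\<close>

lemma det_zero_kernel:
  fixes f :: "nat \<Rightarrow> nat \<Rightarrow> complex"
  shows "det (mat N N (\<lambda>(i, j). f i j)) = 0 \<longleftrightarrow>
    (\<exists>x. (\<exists>i<N. x i \<noteq> 0) \<and> (\<forall>i<N. app N f x i = 0))"
proof -
  let ?F = "mat N N (\<lambda>(i, j). f i j)"
  have F: "?F \<in> carrier_mat N N" by simp
  have mv: "?F *\<^sub>v v = vec N (app N f (\<lambda>i. v $ i))" if "v \<in> carrier_vec N" for v
    using that by (auto simp: app_def scalar_prod_def atLeast0LessThan)
  show ?thesis unfolding det_0_iff_vec_prod_zero_field[OF F]
  proof
    assume "\<exists>v. v \<in> carrier_vec N \<and> v \<noteq> 0\<^sub>v N \<and> ?F *\<^sub>v v = 0\<^sub>v N"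
    then obtain v where v: "v \<in> carrier_vec N" "v \<noteq> 0\<^sub>v N" "?F *\<^sub>v v = 0\<^sub>v N" by blast
    have "\<exists>i<N. v $ i \<noteq> 0" using v(1,2) by (metis carrier_vecD eq_vecI index_zero_vec)
    moreover have "app N f (\<lambda>i. v $ i) i = 0" if "i < N" for i
      using v(3) that unfolding mv[OF v(1)] by (metis index_vec index_zero_vec(1))
    ultimately show "\<exists>x. (\<exists>i<N. x i \<noteq> 0) \<and> (\<forall>i<N. app N f x i = 0)" by blast
  next
    assume "\<exists>x. (\<exists>i<N. x i \<noteq> 0) \<and> (\<forall>i<N. app N f x i = 0)"
    then obtain x where x: "\<exists>i<N. x i \<noteq> 0" "\<forall>i<N. app N f x i = 0" by blast
    have "?F *\<^sub>v vec N x = vec N (app N f x)"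
      unfolding mv[OF vec_carrier] by (intro eq_vecI) (auto simp: app_def)
    moreover have "vec N x \<noteq> 0\<^sub>v N" using x(1) by (metis index_vec index_zero_vec(1))
    ultimately show "\<exists>v. v \<in> carrier_vec N \<and> v \<noteq> 0\<^sub>v N \<and> ?F *\<^sub>v v = 0\<^sub>v N"
      using x(2) by (intro exI[of _ "vec N x"]) auto
  qed
qed

section \<open>Averaging over roots of unity and the lower bound for the radius\<close>

lemma root_of_unity_orthogonality:
  fixes K :: nat
  defines "\<omega> \<equiv> cis (2 * pi / real K)"
  assumes "k < K" "l < K"
  shows "(\<Sum>r<K. \<omega> ^ (r * k) * cnj (\<omega> ^ (r * l))) = (if k = l then of_nat K else 0)"
proof -
  \<comment> \<open>As \<omega> is unimodular, q is the power of \<omega> with exponent k - l, a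
    K-th root of unity; the sum is geometric with ratio q and vanishes unless q = 1.\<close>
  define q where "q = \<omega> ^ k * cnj (\<omega> ^ l)"
  have K: "0 < K" using assms by simp
  have \<omega>K: "\<omega> ^ K = 1" using K by (simp add: \<omega>_def Complex.DeMoivre)
  have \<omega>n: "\<omega> ^ j * cnj (\<omega> ^ j) = 1" for j
    by (simp add: \<omega>_def Complex.DeMoivre cis_cnj cis_mult)
  have qr: "\<omega> ^ (r * k) * cnj (\<omega> ^ (r * l)) = q ^ r" for r
    by (simp add: q_def power_mult_distrib power_mult[symmetric] mult.commute)
  have qK: "q ^ K = 1"
  proof -
    have "q ^ K = (\<omega> ^ K) ^ k * cnj ((\<omega> ^ K) ^ l)"
      unfolding q_def power_mult_distrib complex_cnj_power power_mult[symmetric] by (simp only: mult.commute)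
    then show ?thesis unfolding \<omega>K by simp
  qed
  have q1: "q = 1 \<longleftrightarrow> k = l"
  proof
    assume "q = 1"
    have "\<omega> ^ k = \<omega> ^ k * (\<omega> ^ l * cnj (\<omega> ^ l))" using \<omega>n by simp
    also have "\<dots> = q * \<omega> ^ l" by (simp add: q_def)
    finally have "\<omega> ^ k = \<omega> ^ l" using \<open>q = 1\<close> by simp
    then have "cis (2 * pi * real k / real K) = cis (2 * pi * real l / real K)"
      by (simp add: \<omega>_def Complex.DeMoivre mult.commute)
    with bij_betw_roots_unity[OF K] show "k = l"
      using assms unfolding bij_betw_def inj_on_def by blast
  qed (use \<omega>n in \<open>simp add: q_def\<close>)
  show ?thesis
  proof (cases "k = l")
    case True
    then show ?thesis unfolding qr using q1 by simp
  next
    case False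
    then have "q \<noteq> 1" using q1 by simp
    then show ?thesis unfolding qr using qK False by (simp add: geometric_sum)
  qed
qed

lemma ip_scale: "ip N (\<lambda>i. c * x i) (\<lambda>i. d * y i) = c * cnj d * ip N x y"
  by (simp add: ip_def sum_distrib_left algebra_simps)

text \<open>Discrete Parseval identity for vector coefficients: orthogonality of the characters
  removes every pairing with k different from l.\<close>

lemma root_of_unity_Parseval:
  fixes K :: nat
  defines "\<omega> \<equiv> cis (2 * pi / real K)"
  shows "(\<Sum>r<K. ip N (\<lambda>i. \<Sum>k<K. \<omega> ^ (r * k) * a k i) (\<lambda>i. \<Sum>l<K. \<omega> ^ (r * l) * b l i))
    = of_nat K * (\<Sum>k<K. ip N (a k) (b k))"
proof -
  have "(\<Sum>r<K. ip N (\<lambda>i. \<Sum>k<K. \<omega> ^ (r * k) * a k i) (\<lambda>i. \<Sum>l<K. \<omega> ^ (r * l) * b l i))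
    = (\<Sum>r<K. \<Sum>k<K. \<Sum>l<K. \<omega> ^ (r * k) * cnj (\<omega> ^ (r * l)) * ip N (a k) (b l))"
    by (simp only: ip_sum_sum ip_scale)
  also have "\<dots> = (\<Sum>k<K. \<Sum>r<K. \<Sum>l<K. \<omega> ^ (r * k) * cnj (\<omega> ^ (r * l)) * ip N (a k) (b l))"
    by (rule sum.swap)
  also have "\<dots> = (\<Sum>k<K. \<Sum>l<K. \<Sum>r<K. \<omega> ^ (r * k) * cnj (\<omega> ^ (r * l)) * ip N (a k) (b l))"
    by (intro sum.cong refl sum.swap)
  also have "\<dots> = (\<Sum>k<K. \<Sum>l<K. if k = l then of_nat K * ip N (a k) (b l) else 0)"
  proof (intro sum.cong refl)
    fix k l assume "k \<in> {..<K}" "l \<in> {..<K}"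
    then show "(\<Sum>r<K. \<omega> ^ (r * k) * cnj (\<omega> ^ (r * l)) * ip N (a k) (b l))
        = (if k = l then of_nat K * ip N (a k) (b l) else 0)"
      using root_of_unity_orthogonality[of k K l]
      unfolding sum_distrib_right[symmetric] \<omega>_def by auto
  qed
  also have "\<dots> = of_nat K * (\<Sum>k<K. ip N (a k) (b k))"
    by (simp add: sum.delta sum_distrib_left)
  finally show ?thesis .
qed

text \<open>The equality case of \<open>sum_adjacent_le_cos\<close>. Multiply the recurrence by
  \<open>s (Suc k)\<close> and sum; both adjacent sums agree because s vanishes at 0 and at n +
  1.\<close>

lemma sum_adjacent_sin:
  fixes n :: nat
  defines "s \<equiv> \<lambda>k. sin (real k * (pi / real (n + 1)))"
  shows "(\<Sum>k<n. s (Suc k) * s (Suc (Suc k))) = cos (pi / real (n + 1)) * (\<Sum>k<n. (s (Suc k))\<^sup>2)"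
proof -
  have s0: "s 0 = 0" by (simp add: s_def)
  have sn: "s (Suc n) = 0" by (simp add: s_def)
  have rec: "s k + s (Suc (Suc k)) = 2 * cos (pi / real (n + 1)) * s (Suc k)" for k
    using sin_recurrence[of "real k" "pi / real (n + 1)"]
    by (simp add: s_def add.commute add.left_commute)
  have "(\<Sum>k<n. s k * s (Suc k)) = (\<Sum>k<Suc n. s k * s (Suc k))" using sn by simp
  also have "\<dots> = (\<Sum>k<n. s (Suc k) * s (Suc (Suc k)))"
    unfolding sum.lessThan_Suc_shift s0 by simp
  finally have shift: "(\<Sum>k<n. s k * s (Suc k)) = (\<Sum>k<n. s (Suc k) * s (Suc (Suc k)))" .
  have "2 * cos (pi / real (n + 1)) * (\<Sum>k<n. (s (Suc k))\<^sup>2)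
      = (\<Sum>k<n. s k * s (Suc k) + s (Suc k) * s (Suc (Suc k)))"
    unfolding sum_distrib_left
  proof (rule sum.cong)
    fix k
    have "2 * cos (pi / real (n + 1)) * (s (Suc k))\<^sup>2 = (s k + s (Suc (Suc k))) * s (Suc k)"
      unfolding rec power2_eq_square by (rule mult.assoc[symmetric])
    then show "2 * cos (pi / real (n + 1)) * (s (Suc k))\<^sup>2 = s k * s (Suc k) + s (Suc k) * s (Suc (Suc k))"
      by (simp add: distrib_left distrib_right mult.commute)
  qed simp
  also have "\<dots> = (\<Sum>k<n. s k * s (Suc k)) + (\<Sum>k<n. s (Suc k) * s (Suc (Suc k)))"
    by (rule sum.distrib)
  finally show ?thesis using shift by simp
qed

text \<open>The test vectors are \<open>\<Sum>\<^sub>k \<omega>\<^sup>k sin ((k+1)\<theta>) x\<^sub>k\<close> with \<open>\<theta> = \<pi>/(n+1)\<close>. The \<open>x\<^sub>k\<close> need not be orthogonal,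
  but averaging over the \<open>(n+1)\<close>-st roots of unity \<open>\<omega>\<close> removes all cross terms.\<close>

lemma chain_lower_bound:
  assumes n: "0 < n"
    and chain: "\<And>k i. Suc k < n \<Longrightarrow> i < N \<Longrightarrow> app N M (x k) i = x (Suc k) i"
    and unit: "\<And>k. k < n \<Longrightarrow> sq N (x k) = 1"
    and bound: "\<And>y. cmod (ip N (app N M y) y) \<le> \<rho> * sq N y"
  shows "cos (pi / real (n + 1)) \<le> \<rho>"
proof -
  \<comment> \<open>One more than the length of the chain: multiplication by \<omega> raises each
    frequency by one, and frequency n must not coincide with frequency 0. The extra coefficient
    \<open>a n\<close> is 0.\<close>
  define K where "K = Suc n"
  define \<omega> where "\<omega> = cis (2 * pi / real K)"
  define s where "s = (\<lambda>k. sin (real k * (pi / real (n + 1))))"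
  have sn: "s (Suc n) = 0" by (simp add: s_def)
  define a where "a k = (\<lambda>i. of_real (s (Suc k)) * x k i)" for k
  \<comment> \<open>The images of the \<open>a k\<close>, moved up by one slot, so that \<omega>^r
    times M \<open>y r\<close> is again a Fourier sum.\<close>
  define b where "b k = (\<lambda>i. if k = 0 then 0 else app N M (a (k - 1)) i)" for k
  define y where "y r = (\<lambda>i. \<Sum>k<K. \<omega> ^ (r * k) * a k i)" for r
  have an: "a n i = 0" for i using sn by (simp add: a_def)
  have cm: "cmod (\<omega> ^ r) = 1" for r by (simp add: \<omega>_def norm_power)
  have My: "\<omega> ^ r * app N M (y r) i = (\<Sum>k<K. \<omega> ^ (r * k) * b k i)" if "i < N" for r i
  proof -
    have "app N M (y r) i = (\<Sum>k<K. \<omega> ^ (r * k) * app N M (a k) i)"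
      unfolding y_def app_sum app_scale by simp
    also have "\<dots> = (\<Sum>k<n. \<omega> ^ (r * k) * app N M (a k) i)"
      using an by (simp add: K_def app_def)
    finally have "\<omega> ^ r * app N M (y r) i = (\<Sum>k<n. \<omega> ^ (r * Suc k) * b (Suc k) i)"
      by (simp add: b_def sum_distrib_left power_add mult.assoc)
    also have "\<dots> = (\<Sum>k<K. \<omega> ^ (r * k) * b k i)"
      unfolding K_def sum.lessThan_Suc_shift by (simp add: b_def)
    finally show ?thesis .
  qed
  have sqa: "ip N (a k) (a k) = of_real ((s (Suc k))\<^sup>2)" if "k < n" for k
    unfolding ip_self a_def sq_scale using unit[OF that] by simp
  have norms: "(\<Sum>r<K. sq N (y r)) = real K * (\<Sum>k<n. (s (Suc k))\<^sup>2)"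
  proof -
    have "complex_of_real (\<Sum>r<K. sq N (y r)) = (\<Sum>r<K. ip N (y r) (y r))" by (simp add: ip_self)
    also have "\<dots> = of_nat K * (\<Sum>k<K. ip N (a k) (a k))"
      unfolding y_def \<omega>_def by (rule root_of_unity_Parseval)
    also have "(\<Sum>k<K. ip N (a k) (a k)) = (\<Sum>k<n. of_real ((s (Suc k))\<^sup>2))"
      using sqa an by (simp add: K_def ip_def)
    finally have "complex_of_real (\<Sum>r<K. sq N (y r)) = of_real (real K * (\<Sum>k<n. (s (Suc k))\<^sup>2))"
      by simp
    then show ?thesis using of_real_eq_iff by blast
  qed
  have forms: "(\<Sum>r<K. \<omega> ^ r * ip N (app N M (y r)) (y r)) =
      of_real (real K * (\<Sum>k<n. s (Suc k) * s (Suc (Suc k))))"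
  proof -
    have "\<omega> ^ r * ip N (app N M (y r)) (y r) = ip N (\<lambda>i. \<Sum>k<K. \<omega> ^ (r * k) * b k i) (y r)" for r
      using My by (simp add: ip_def sum_distrib_left mult.assoc[symmetric])
    then have "(\<Sum>r<K. \<omega> ^ r * ip N (app N M (y r)) (y r)) = of_nat K * (\<Sum>k<K. ip N (b k) (a k))"
      unfolding y_def \<omega>_def using root_of_unity_Parseval[of N K b a] by simp
    also have "(\<Sum>k<K. ip N (b k) (a k)) = (\<Sum>k<n. ip N (b (Suc k)) (a (Suc k)))"
      unfolding K_def sum.lessThan_Suc_shift by (simp add: b_def ip_def)
    also have "\<dots> = (\<Sum>k<n. of_real (s (Suc k) * s (Suc (Suc k))))"
    proof (rule sum.cong)
      fix k assume k: "k \<in> {..<n}"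
      show "ip N (b (Suc k)) (a (Suc k)) = of_real (s (Suc k) * s (Suc (Suc k)))"
      proof (cases "Suc k = n")
        case True
        \<comment> \<open>The last image is not controlled by \<open>chain\<close>, but it is paired
          with \<open>a n = 0\<close>.\<close>
        then show ?thesis using an sn by (simp add: ip_def)
      next
        case False
        then have k': "Suc k < n" using k by simp
        have "ip N (b (Suc k)) (a (Suc k)) =
          ip N (\<lambda>i. of_real (s (Suc k)) * x (Suc k) i) (\<lambda>i. of_real (s (Suc (Suc k))) * x (Suc k) i)"
          using chain[OF k'] by (intro ip_cong) (auto simp: b_def a_def app_scale)
        then show ?thesis using unit[OF k'] by (simp add: ip_scale ip_self)
      qed
    qed simp
    finally show ?thesis by simp
  qed
  have "real K * (\<Sum>k<n. s (Suc k) * s (Suc (Suc k))) \<le> cmod (\<Sum>r<K. \<omega> ^ r * ip N (app N M (y r)) (y r))"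
    unfolding forms norm_of_real by simp
  also have "\<dots> \<le> (\<Sum>r<K. \<rho> * sq N (y r))"
    by (rule order_trans[OF norm_sum]) (intro sum_mono, simp add: norm_mult cm bound)
  also have "\<dots> = real K * (\<rho> * (\<Sum>k<n. (s (Suc k))\<^sup>2))"
    unfolding sum_distrib_left[symmetric] norms by simp
  finally have "(\<Sum>k<n. s (Suc k) * s (Suc (Suc k))) \<le> \<rho> * (\<Sum>k<n. (s (Suc k))\<^sup>2)"
    by (simp add: K_def)
  then have "cos (pi / real (n + 1)) * (\<Sum>k<n. (s (Suc k))\<^sup>2) \<le> \<rho> * (\<Sum>k<n. (s (Suc k))\<^sup>2)"
    using sum_adjacent_sin[of n] by (simp add: s_def)
  moreover have "0 < s (Suc k)" if "k < n" for k
    using sin_grid_pos[of "Suc k" n] that unfolding s_def by simp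
  then have "0 < (\<Sum>k<n. (s (Suc k))\<^sup>2)"
    using n by (intro sum_pos zero_less_power) auto
  ultimately show ?thesis by simp
qed

section \<open>Vectors at which the numerical radius is attained\<close>

lemma app_add: "app N M (\<lambda>i. x i + y i) = (\<lambda>i. app N M x i + app N M y i)"
  by (simp add: fun_eq_iff app_def algebra_simps sum.distrib)

lemma ip_expand:
  "ip N (\<lambda>i. u i + c * v i) (\<lambda>i. x i + d * y i)
    = ip N u x + cnj d * ip N u y + c * ip N v x + c * cnj d * ip N v y"
proof -
  have "ip N (\<lambda>i. u i + c * v i) (\<lambda>i. x i + d * y i) = (\<Sum>i<N. u i * cnj (x i)
      + cnj d * (u i * cnj (y i)) + c * (v i * cnj (x i)) + c * cnj d * (v i * cnj (y i)))"
    unfolding ip_def by (rule sum.cong) (auto simp: algebra_simps)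
  then show ?thesis by (simp only: ip_def sum.distrib sum_distrib_left)
qed

text \<open>Variation in the direction r = h x: the form at x + e r is 2 e S + e^2 f, where S is the
  squared norm of r. It can be nonnegative for small negative e only if S = 0.\<close>

lemma psd_kernel:
  assumes herm: "\<And>i j. h j i = cnj (h i j)"
    and psd: "\<And>y. 0 \<le> Re (ip N (app N h y) y)"
    and zero: "Re (ip N (app N h x) x) = 0"
    and i: "i < N"
  shows "app N h x i = 0"
proof -
  define r where "r = app N h x"
  define S where "S = sq N r"
  define f where "f = Re (ip N (app N h r) r)"
  have f: "0 \<le> f" unfolding f_def by (rule psd)
  have "ip N (app N h r) x = ip N r (app N (\<lambda>i j. cnj (h j i)) x)"
    by (rule ip_app_adjoint)
  also have "(\<lambda>i j. cnj (h j i)) = h" by (intro ext) (rule herm[symmetric])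
  finally have cross: "ip N (app N h r) x = of_real S" by (simp add: r_def S_def ip_self)
  have exp: "Re (ip N (app N h (\<lambda>i. x i + of_real e * r i)) (\<lambda>i. x i + of_real e * r i)) = 2 * e * S + e\<^sup>2 * f" for e
  proof -
    have "ip N (app N h (\<lambda>i. x i + of_real e * r i)) (\<lambda>i. x i + of_real e * r i)
       = ip N (app N h x) x + cnj (of_real e) * ip N (app N h x) r + of_real e * ip N (app N h r) x
         + of_real e * cnj (of_real e) * ip N (app N h r) r"
      unfolding app_add app_scale by (rule ip_expand)
    also have "ip N (app N h x) r = of_real S" by (simp add: r_def S_def ip_self)
    finally show ?thesis using zero unfolding cross f_def by (simp add: power2_eq_square algebra_simps)
  qed
  \<comment> \<open>The test value is e = - S / (f + 1); the summand 1 keeps the denominator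
    positive when f = 0.\<close>
  define d where "d = f + 1"
  have d: "1 \<le> d" "f = d - 1" using f by (auto simp: d_def)
  have "0 \<le> 2 * (- S / d) * S + (- S / d)\<^sup>2 * f"
    using psd[of "\<lambda>i. x i + of_real (- S / d) * r i"] unfolding exp .
  also have "\<dots> = - (S\<^sup>2 * (d + 1)) / d\<^sup>2"
    using d(1) unfolding d(2) by (simp add: field_simps power2_eq_square)
  finally have "S\<^sup>2 * (d + 1) \<le> 0" using d by (simp add: divide_le_0_iff)
  then have "S = 0" using d by (simp add: mult_le_0_iff)
  then show ?thesis using i unfolding S_def sq_eq_0_iff r_def by blast
qed

text \<open>The Hermitian matrix h, which is 2 \<rho> minus twice the real part of
  \<open>cnj t\<close> times M, is positive semidefinite by \<open>bound\<close>, and its form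
  vanishes at x. Hence h x = 0 by \<open>psd_kernel\<close>; multiplication by t gives the
  equation.\<close>

lemma numerical_radius_attained_kernel:
  assumes bound: "\<And>y. cmod (ip N (app N M y) y) \<le> \<rho> * sq N y"
    and t: "cmod t = 1"
    and eq: "ip N (app N M x) x = of_real (\<rho> * sq N x) * t"
    and i: "i < N"
  shows "app N M x i + t\<^sup>2 * app N (\<lambda>i j. cnj (M j i)) x i = 2 * of_real \<rho> * t * x i"
proof -
  define h where "h i j = (if i = j then 2 * of_real \<rho> else 0) - cnj t * M i j - t * cnj (M j i)" for i j
  have tt: "t * cnj t = 1" using t by (simp add: complex_norm_square[symmetric])
  have app_h: "app N h y i = 2 * of_real \<rho> * y i - cnj t * app N M y i - t * app N (\<lambda>i j. cnj (M j i)) y i"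
    if "i < N" for y i
  proof -
    have "app N h y i = (\<Sum>j<N. (if i = j then 2 * of_real \<rho> * y j else 0) - cnj t * (M i j * y j) - t * (cnj (M j i) * y j))"
      unfolding app_def by (rule sum.cong) (auto simp: h_def algebra_simps)
    also have "\<dots> = 2 * of_real \<rho> * y i - cnj t * app N M y i - t * app N (\<lambda>i j. cnj (M j i)) y i"
      using that by (simp add: sum_subtractf sum.delta app_def sum_distrib_left)
    finally show ?thesis .
  qed
  have form: "Re (ip N (app N h y) y) = 2 * (\<rho> * sq N y - Re (cnj t * ip N (app N M y) y))" for y
  proof -
    have "ip N (app N h y) y = ip N (\<lambda>i. 2 * of_real \<rho> * y i - cnj t * app N M y i - t * app N (\<lambda>i j. cnj (M j i)) y i) y"
      using app_h by (intro ip_cong) auto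
    also have "\<dots> = 2 * of_real \<rho> * ip N y y - cnj t * ip N (app N M y) y - t * ip N (app N (\<lambda>i j. cnj (M j i)) y) y"
      by (simp add: ip_def sum_subtractf sum_distrib_left algebra_simps)
    also have "ip N (app N (\<lambda>i j. cnj (M j i)) y) y = cnj (ip N (app N M y) y)"
    proof -
      have "ip N (app N (\<lambda>i j. cnj (M j i)) y) y = ip N y (app N M y)"
        by (simp add: ip_app_adjoint)
      also have "\<dots> = cnj (ip N (app N M y) y)" by (simp add: ip_def mult.commute)
      finally show ?thesis .
    qed
    finally show ?thesis by (simp add: ip_self)
  qed
  have "app N h x i = 0"
  proof (rule psd_kernel[OF _ _ _ i])
    show "h j i = cnj (h i j)" for i j by (simp add: h_def algebra_simps)
    show "0 \<le> Re (ip N (app N h y) y)" for y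
    proof -
      have "Re (cnj t * ip N (app N M y) y) \<le> cmod (cnj t * ip N (app N M y) y)" by (rule complex_Re_le_cmod)
      also have "\<dots> \<le> \<rho> * sq N y" using bound t by (simp add: norm_mult)
      finally show ?thesis unfolding form by simp
    qed
    have "cnj t * ip N (app N M x) x = of_real (\<rho> * sq N x) * (t * cnj t)"
      unfolding eq by (simp add: mult_ac)
    then have "cnj t * ip N (app N M x) x = of_real (\<rho> * sq N x)" unfolding tt by simp
    then show "Re (ip N (app N h x) x) = 0" unfolding form by simp
  qed
  then have "2 * of_real \<rho> * x i - cnj t * app N M x i - t * app N (\<lambda>i j. cnj (M j i)) x i = 0"
    using app_h[OF i] by simp
  then have "t * (2 * of_real \<rho> * x i - cnj t * app N M x i - t * app N (\<lambda>i j. cnj (M j i)) x i) = 0"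
    by simp
  then have "2 * of_real \<rho> * t * x i - (t * cnj t) * app N M x i - t\<^sup>2 * app N (\<lambda>i j. cnj (M j i)) x i = 0"
    by (simp add: algebra_simps power2_eq_square)
  then show ?thesis unfolding tt by (simp add: algebra_simps)
qed

subsection \<open>Graded matrices\<close>

text \<open>Substituting \<open>x j = t\<^bsup>g j\<^esup> * y j\<close> and cancelling powers of \<open>t\<close> row by row turns the hypothesis into a
  homogeneous system whose coefficients are polynomials in \<open>t\<close>; being singular on the whole unit circle
  it is singular at \<open>t = 0\<close>.\<close>

lemma graded_kernel:
  fixes M :: "nat \<Rightarrow> nat \<Rightarrow> complex" and g :: "nat \<Rightarrow> nat"
  assumes sing: "\<And>t. cmod t = 1 \<Longrightarrow> \<exists>x. (\<exists>i<N. x i \<noteq> 0) \<and>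
      (\<forall>i<N. app N M x i + t\<^sup>2 * app N (\<lambda>i j. cnj (M j i)) x i = 2 * of_real \<rho> * t * x i)"
    and gm: "\<And>i. i < N \<Longrightarrow> g i \<le> m"
    and graded: "\<And>i j. i < N \<Longrightarrow> j < N \<Longrightarrow> M i j \<noteq> 0 \<Longrightarrow> g j = Suc (g i) \<or> g i = m \<and> g j = m"
    and tri: "\<And>i j. i < N \<Longrightarrow> j < i \<Longrightarrow> M i j = 0"
    and diag: "\<And>i. i < N \<Longrightarrow> g i = m \<Longrightarrow> M i i \<noteq> 0"
  shows "\<exists>y. (\<exists>i<N. y i \<noteq> 0) \<and> (\<forall>i<N. y i \<noteq> 0 \<longrightarrow> g i < m) \<and>
      (\<forall>i<N. g i < m \<longrightarrow> app N M y i + app N (\<lambda>i j. cnj (M j i)) y i = 2 * of_real \<rho> * y i)"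
proof -
  \<comment> \<open>Row i after the common factor \<open>t ^ e i\<close> is removed. In rows of
    grade below \<open>m\<close> all terms carry exponent \<open>Suc (g i)\<close>, so nothing
    depends on t. In rows of grade \<open>m\<close> the adjoint and the \<rho> terms keep a positive
    power of t, so only M survives at t = 0.\<close>
  define P where "P i j = (if g i < m then [:M i j + cnj (M j i) - (if i = j then 2 * of_real \<rho> else 0):]
     else [:M i j, (if g j = m then 0 else cnj (M j i)) - (if i = j then 2 * of_real \<rho> else 0),
            (if g j = m then cnj (M j i) else 0):])" for i j
  define e where "e i = (if g i < m then Suc (g i) else m)" for i
  have entry: "M i j * t ^ g j + t\<^sup>2 * cnj (M j i) * t ^ g j - (if i = j then 2 * of_real \<rho> * t * t ^ g j else 0)
      = t ^ e i * poly (P i j) t" if ij: "i < N" "j < N" for i j t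
  proof (cases "g i < m")
    case True
    have 1: "M i j * t ^ g j = M i j * t ^ Suc (g i)"
      using graded[OF ij] True by (cases "M i j = 0") auto
    have 2: "t\<^sup>2 * cnj (M j i) * t ^ g j = cnj (M j i) * t ^ Suc (g i)"
      using graded[OF ij(2,1)] True by (cases "M j i = 0") (auto simp: power2_eq_square)
    show ?thesis unfolding 1 2 using True by (auto simp: P_def e_def algebra_simps)
  next
    case False
    then have gi: "g i = m" using gm ij by (simp add: le_antisym)
    have 1: "M i j * t ^ g j = M i j * t ^ m"
      using graded[OF ij] gi gm[OF ij(2)] by (cases "M i j = 0") auto
    have 2: "t\<^sup>2 * cnj (M j i) * t ^ g j =
        t ^ m * (if g j = m then t\<^sup>2 * cnj (M j i) else t * cnj (M j i))"
      using graded[OF ij(2,1)] gi by (cases "M j i = 0") (auto simp: power2_eq_square)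
    show ?thesis unfolding 1 2 using gi by (auto simp: P_def e_def algebra_simps power2_eq_square)
  qed
  define Q where "Q = mat N N (\<lambda>(i, j). P i j)"
  have poly_det: "poly (det Q) t = det (mat N N (\<lambda>(i, j). poly (P i j) t))" for t
  proof -
    have hom: "comm_ring_hom (\<lambda>p. poly p t)" by unfold_locales auto
    have "map_mat (\<lambda>p. poly p t) Q = mat N N (\<lambda>(i, j). poly (P i j) t)"
      by (rule eq_matI) (auto simp: Q_def)
    then show ?thesis using comm_ring_hom.hom_det[OF hom, of Q] by simp
  qed
  have root: "poly (det Q) t = 0" if t: "cmod t = 1" for t
  proof -
    have t0: "t \<noteq> 0" using t by auto
    obtain x where x: "\<exists>i<N. x i \<noteq> 0"
      and eq: "\<And>i. i < N \<Longrightarrow> app N M x i + t\<^sup>2 * app N (\<lambda>i j. cnj (M j i)) x i = 2 * of_real \<rho> * t * x i"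
      using sing[OF t] by blast
    define y where "y j = x j / t ^ g j" for j
    have xy: "x j = t ^ g j * y j" for j using t0 by (simp add: y_def)
    have "app N (\<lambda>i j. poly (P i j) t) y i = 0" if i: "i < N" for i
    proof -
      have "t ^ e i * app N (\<lambda>i j. poly (P i j) t) y i
        = (\<Sum>j<N. (M i j * t ^ g j + t\<^sup>2 * cnj (M j i) * t ^ g j
            - (if i = j then 2 * of_real \<rho> * t * t ^ g j else 0)) * y j)"
        unfolding app_def sum_distrib_left
        by (rule sum.cong) (use i in \<open>auto simp: entry[symmetric] mult.assoc[symmetric]\<close>)
      also have "\<dots> = (\<Sum>j<N. M i j * x j + t\<^sup>2 * (cnj (M j i) * x j) - (if i = j then 2 * of_real \<rho> * t * x j else 0))"
        by (rule sum.cong) (auto simp: xy algebra_simps)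
      also have "\<dots> = app N M x i + t\<^sup>2 * app N (\<lambda>i j. cnj (M j i)) x i - 2 * of_real \<rho> * t * x i"
        using i by (simp add: sum.distrib sum_subtractf app_def sum_distrib_left)
      also have "\<dots> = 0" using eq[OF i] by simp
      finally show ?thesis using t0 by simp
    qed
    moreover have "\<exists>i<N. y i \<noteq> 0" using x t0 by (auto simp: y_def)
    ultimately show ?thesis unfolding poly_det det_zero_kernel by blast
  qed
  have "infinite {t. cmod t = 1}"
  proof -
    have "infinite (sphere (0::complex) 1)"
    proof
      assume fin: "finite (sphere (0::complex) 1)"
      have "inj_on (\<lambda>s. Complex s (sqrt (1 - s\<^sup>2))) {0..1}" by (auto simp: inj_on_def)
      moreover have "(\<lambda>s. Complex s (sqrt (1 - s\<^sup>2))) ` {0..1} \<subseteq> sphere 0 1"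
        by (auto simp: cmod_def power_le_one_iff abs_square_le_1)
      ultimately have "finite {0..1::real}" using fin by (meson finite_imageD finite_subset)
      then show False using infinite_Icc[of "0::real" 1] by simp
    qed
    then show ?thesis by (simp add: sphere_def)
  qed
  then have "det Q = 0" using root poly_roots_finite[of "det Q"] finite_subset[of "{t. cmod t = 1}" "{x. poly (det Q) x = 0}"]
    by blast
  then have "det (mat N N (\<lambda>(i, j). poly (P i j) 0)) = 0" using poly_det[of 0] by simp
  then obtain y where y: "\<exists>i<N. y i \<noteq> 0" and ker: "\<And>i. i < N \<Longrightarrow> app N (\<lambda>i j. poly (P i j) 0) y i = 0"
    unfolding det_zero_kernel by blast
  \<comment> \<open>Back substitution from the last index: at t = 0 the rows of grade
    \<open>m\<close> form a triangular system with nonzero diagonal that involves only unknowns of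
    grade \<open>m\<close>.\<close>
  have supp: "g i = m \<Longrightarrow> y i = 0" if "i < N" for i
    using that
  proof (induction "N - i" arbitrary: i rule: less_induct)
    case less
    have "0 = (\<Sum>j<N. M i j * y j)"
      using ker[OF less.prems(2)] less.prems by (simp add: app_def P_def)
    also have "\<dots> = (\<Sum>j<N. if j = i then M i i * y i else 0)"
    proof (rule sum.cong)
      fix j assume j: "j \<in> {..<N}"
      consider "j < i" | "j = i" | "i < j" by linarith
      then show "M i j * y j = (if j = i then M i i * y i else 0)"
      proof cases
        case 3
        have "y j = 0" if "M i j \<noteq> 0"
          using graded[of i j] that less.prems j gm[of j] 3 less.hyps[of j] by auto
        then show ?thesis using 3 by auto
      qed (use tri less.prems in auto)
    qed simp
    also have "\<dots> = M i i * y i" using less.prems by simp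
    finally show ?case using diag less.prems by simp
  qed
  have "app N M y i + app N (\<lambda>i j. cnj (M j i)) y i = 2 * of_real \<rho> * y i" if i: "i < N" "g i < m" for i
  proof -
    have "app N (\<lambda>i j. poly (P i j) 0) y i
        = (\<Sum>j<N. M i j * y j + cnj (M j i) * y j - (if i = j then 2 * of_real \<rho> * y j else 0))"
      unfolding app_def
      by (rule sum.cong) (use i in \<open>auto simp: P_def algebra_simps\<close>)
    also have "\<dots> = app N M y i + app N (\<lambda>i j. cnj (M j i)) y i - 2 * of_real \<rho> * y i"
      using i by (simp add: sum.distrib sum_subtractf app_def)
    finally show ?thesis using ker[OF i(1)] by simp
  qed
  moreover have "\<forall>i<N. y i \<noteq> 0 \<longrightarrow> g i < m" using supp gm le_neq_implies_less by blast
  ultimately show ?thesis using y by blast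
qed

text \<open>The nonzero y from \<open>graded_kernel\<close> is supported in grades below
  \<open>m\<close>, so \<open>m\<close> is positive. Pairing its equation with y gives \<rho>
  \<open>sq N y\<close> as the real part of the form at y, which \<open>block_shift_bound\<close>
  estimates. Contractivity is asked for only when \<open>0 < m\<close>, and it enters after that has
  been shown.\<close>

lemma graded_disc_radius_le:
  assumes bound: "\<And>y. cmod (ip N (app N M y) y) \<le> \<rho> * sq N y"
    and att: "\<And>t. cmod t = 1 \<Longrightarrow> \<exists>x. sq N x = 1 \<and> ip N (app N M x) x = of_real \<rho> * t"
    and gm: "\<And>i. i < N \<Longrightarrow> g i \<le> m"
    and graded: "\<And>i j. i < N \<Longrightarrow> j < N \<Longrightarrow> M i j \<noteq> 0 \<Longrightarrow> g j = Suc (g i) \<or> g i = m \<and> g j = m"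
    and tri: "\<And>i j. i < N \<Longrightarrow> j < i \<Longrightarrow> M i j = 0"
    and diag: "\<And>i. i < N \<Longrightarrow> g i = m \<Longrightarrow> M i i \<noteq> 0"
    and contr: "\<And>y. 0 < m \<Longrightarrow> sq N (app N M y) \<le> sq N y"
  shows "0 < m \<and> \<rho> \<le> cos (pi / real (m + 1))"
proof -
  have sing: "\<exists>x. (\<exists>i<N. x i \<noteq> 0) \<and>
      (\<forall>i<N. app N M x i + t\<^sup>2 * app N (\<lambda>i j. cnj (M j i)) x i = 2 * of_real \<rho> * t * x i)"
    if t: "cmod t = 1" for t
  proof -
    obtain x where x: "sq N x = 1" "ip N (app N M x) x = of_real \<rho> * t" using att[OF t] by blast
    have "\<exists>i<N. x i \<noteq> 0" using x(1) sq_eq_0_iff[of N x] by auto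
    moreover have "app N M x i + t\<^sup>2 * app N (\<lambda>i j. cnj (M j i)) x i = 2 * of_real \<rho> * t * x i"
      if "i < N" for i
      by (rule numerical_radius_attained_kernel[OF bound t _ that]) (use x in simp)
    ultimately show ?thesis by blast
  qed
  from graded_kernel[where g = g and m = m, OF sing gm graded tri diag]
  obtain y where y: "\<exists>i<N. y i \<noteq> 0" and supp: "\<And>i. i < N \<Longrightarrow> y i \<noteq> 0 \<Longrightarrow> g i < m"
    and eq: "\<And>i. i < N \<Longrightarrow> g i < m \<Longrightarrow> app N M y i + app N (\<lambda>i j. cnj (M j i)) y i = 2 * of_real \<rho> * y i"
    by blast
  have m: "0 < m" using y supp by fastforce
  have "2 * of_real \<rho> * ip N y y = ip N (\<lambda>i. app N M y i + app N (\<lambda>i j. cnj (M j i)) y i) y"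
  proof -
    have "(app N M y i + app N (\<lambda>i j. cnj (M j i)) y i) * cnj (y i) = 2 * of_real \<rho> * (y i * cnj (y i))" if "i < N" for i
      using eq[OF that] supp[OF that] by (cases "y i = 0") auto
    then have "(\<Sum>i<N. 2 * of_real \<rho> * (y i * cnj (y i))) =
        (\<Sum>i<N. (app N M y i + app N (\<lambda>i j. cnj (M j i)) y i) * cnj (y i))"
      by (intro sum.cong refl) (metis lessThan_iff)
    then show ?thesis by (simp add: ip_def sum_distrib_left)
  qed
  also have "\<dots> = ip N (app N M y) y + ip N (app N (\<lambda>i j. cnj (M j i)) y) y"
    by (simp add: ip_def sum.distrib distrib_right)
  also have "ip N (app N (\<lambda>i j. cnj (M j i)) y) y = ip N y (app N M y)"
    by (simp add: ip_app_adjoint)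
  also have "\<dots> = cnj (ip N (app N M y) y)" by (simp add: ip_def mult.commute)
  finally have "Re (2 * of_real \<rho> * ip N y y) = 2 * Re (ip N (app N M y) y)" by simp
  then have "\<rho> * sq N y = Re (ip N (app N M y) y)" by (simp add: ip_self)
  also have "\<dots> \<le> cmod (ip N (app N M y) y)" by (rule complex_Re_le_cmod)
  also have "\<dots> \<le> cos (pi / real (m + 1)) * sq N y"
    using contr[OF m] supp
  proof (intro block_shift_bound)
    show "g j = Suc (g i)" if "i < N" "j < N" "M i j \<noteq> 0" "g j < m" for i j
      using graded[OF that(1-3)] that(4) by auto
  qed
  finally have "\<rho> \<le> cos (pi / real (m + 1))"
    using y sq_pos[of _ N y] by (auto simp: mult_le_cancel_right)
  with m show ?thesis by simp
qed

text \<open>The hypothesis says that M^* M is the diagonal matrix of the \<open>d j\<close>; this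
  covers isometries and partial isometries alike.\<close>

lemma sq_app_orthogonal_columns:
  assumes "\<And>j k. j < N \<Longrightarrow> k < N \<Longrightarrow>
      (\<Sum>i<N. cnj (M i j) * M i k) = (if j = k then of_real (d j) else 0)"
  shows "sq N (app N M y) = (\<Sum>j<N. d j * (cmod (y j))\<^sup>2)"
proof -
  have "of_real (sq N (app N M y)) = ip N (app N M y) (app N M y)" by (simp add: ip_self)
  also have "\<dots> = ip N (\<lambda>i. \<Sum>k<N. M i k * y k) (\<lambda>i. \<Sum>j<N. M i j * y j)"
    by (rule ip_cong) (auto simp: app_def)
  also have "\<dots> = (\<Sum>k<N. \<Sum>j<N. ip N (\<lambda>i. M i k * y k) (\<lambda>i. M i j * y j))"
    by (rule ip_sum_sum)
  also have "\<dots> = (\<Sum>k<N. \<Sum>j<N. if k = j then of_real (d j) * (y j * cnj (y j)) else 0)"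
  proof (intro sum.cong refl)
    fix k j assume "k \<in> {..<N}" "j \<in> {..<N}"
    have "ip N (\<lambda>i. M i k * y k) (\<lambda>i. M i j * y j) = (\<Sum>i<N. cnj (M i j) * M i k) * (y k * cnj (y j))"
      unfolding ip_def sum_distrib_right by (simp add: mult_ac)
    then show "ip N (\<lambda>i. M i k * y k) (\<lambda>i. M i j * y j) = (if k = j then of_real (d j) * (y j * cnj (y j)) else 0)"
      using assms[of j k] \<open>k \<in> _\<close> \<open>j \<in> _\<close> by auto
  qed
  also have "\<dots> = (\<Sum>j<N. of_real (d j) * (y j * cnj (y j)))" by simp
  also have "\<dots> = of_real (\<Sum>j<N. d j * (cmod (y j))\<^sup>2)"
    by (simp only: of_real_sum of_real_mult complex_norm_square)
  finally show ?thesis using of_real_eq_iff by blast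
qed

subsection \<open>Tensor squares and the triangular normal form\<close>

definition kron :: "nat \<Rightarrow> (nat \<Rightarrow> nat \<Rightarrow> complex) \<Rightarrow> nat \<Rightarrow> nat \<Rightarrow> complex" where
  "kron n B p q = B (p div n) (q div n) * B (p mod n) (q mod n)"

lemma div_mod_less:
  fixes p n :: nat
  assumes "p < n * n" shows "p div n < n" "p mod n < n"
proof -
  have "0 < n" using assms by (cases n) auto
  then show "p mod n < n" by simp
  show "p div n < n" using assms by (simp add: less_mult_imp_div_less)
qed

lemma sum_div_mod:
  fixes n :: nat
  shows "(\<Sum>p<n*n. f (p div n) (p mod n)) = (\<Sum>i<n. \<Sum>j<n. f i j)"
proof -
  have less: "i * n + j < n * n" if "i < n" "j < n" for i j :: nat
  proof -
    have "i * n + j < Suc i * n" using that by simp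
    also have "\<dots> \<le> n * n" using that by (intro mult_right_mono) auto
    finally show ?thesis .
  qed
  have "(\<Sum>p<n*n. f (p div n) (p mod n)) = (\<Sum>(i, j)\<in>{..<n} \<times> {..<n}. f i j)"
    by (rule sum.reindex_bij_witness[where j = "\<lambda>p. (p div n, p mod n)" and i = "\<lambda>(i, j). i * n + j"])
      (auto simp: div_mod_less less)
  then show ?thesis by (simp add: sum.cartesian_product)
qed

lemma sum_div_mod_product:
  fixes n :: nat and a b :: "nat \<Rightarrow> complex"
  shows "(\<Sum>p<n*n. a (p div n) * b (p mod n)) = (\<Sum>i<n. a i) * (\<Sum>j<n. b j)"
  by (simp add: sum_div_mod[of "\<lambda>i j. a i * b j"] sum_product)

lemma app_kron_tensor:
  "app (n*n) (kron n B) (\<lambda>p. x (p div n) * y (p mod n)) p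
    = app n B x (p div n) * app n B y (p mod n)"
proof -
  have "app (n*n) (kron n B) (\<lambda>p. x (p div n) * y (p mod n)) p =
    (\<Sum>q<n*n. (B (p div n) (q div n) * x (q div n)) * (B (p mod n) (q mod n) * y (q mod n)))"
    unfolding app_def kron_def by (rule sum.cong) (auto simp: mult_ac)
  also have "\<dots> = app n B x (p div n) * app n B y (p mod n)"
    unfolding app_def by (rule sum_div_mod_product)
  finally show ?thesis .
qed

lemma sq_tensor: "sq (n*n) (\<lambda>p. x (p div n) * y (p mod n)) = sq n x * sq n y"
  unfolding sq_def norm_mult power_mult_distrib
  by (simp add: sum_div_mod[of "\<lambda>i j. (cmod (x i))\<^sup>2 * (cmod (y j))\<^sup>2"] sum_product)

text \<open>The Gram matrix of a tensor square is the tensor square of the Gram matrix, hence again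
  diagonal.\<close>

lemma kron_orthogonal_columns:
  assumes cols: "\<And>j k. j < n \<Longrightarrow> k < n \<Longrightarrow>
      (\<Sum>i<n. cnj (B i j) * B i k) = (if j = k then of_real (d j) else 0)"
    and pq: "p < n * n" "q < n * n"
  shows "(\<Sum>i<n*n. cnj (kron n B i p) * kron n B i q)
    = (if p = q then of_real (d (p div n) * d (p mod n)) else 0)"
proof -
  have "(\<Sum>i<n*n. cnj (kron n B i p) * kron n B i q) =
     (\<Sum>i<n*n. (cnj (B (i div n) (p div n)) * B (i div n) (q div n)) *
        (cnj (B (i mod n) (p mod n)) * B (i mod n) (q mod n)))"
    unfolding kron_def by (rule sum.cong) (auto simp: mult_ac)
  also have "\<dots> = (\<Sum>i<n. cnj (B i (p div n)) * B i (q div n)) * (\<Sum>i<n. cnj (B i (p mod n)) * B i (q mod n))"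
    by (rule sum_div_mod_product)
  also have "\<dots> = (if p = q then of_real (d (p div n) * d (p mod n)) else 0)"
    using cols[OF div_mod_less(1)[OF pq(1)] div_mod_less(1)[OF pq(2)]]
      cols[OF div_mod_less(2)[OF pq(1)] div_mod_less(2)[OF pq(2)]]
    by auto (metis div_mult_mod_eq)
  finally show ?thesis .
qed

text \<open>The normal form: m is the algebraic multiplicity of the eigenvalue 0, and
  \<open>cols\<close> says that B^* B is diag(0, 1, ..., 1). The guard \<open>0 < m\<close> is
  essential, since for m = 0 the triangular B is invertible while that diagonal matrix is
  singular.\<close>

locale nilpotent_first =
  fixes n m :: nat and B :: "nat \<Rightarrow> nat \<Rightarrow> complex"
  assumes m_le: "m \<le> n"
    and tri: "\<And>i j. i < n \<Longrightarrow> j < i \<Longrightarrow> B i j = 0"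
    and diag_0: "\<And>i. i < m \<Longrightarrow> B i i = 0"
    and diag: "\<And>i. m \<le> i \<Longrightarrow> i < n \<Longrightarrow> B i i \<noteq> 0"
    and cols: "\<And>j k. 0 < m \<Longrightarrow> j < n \<Longrightarrow> k < n \<Longrightarrow>
      (\<Sum>i<n. cnj (B i j) * B i k) = (if j = k then of_bool (0 < j) else 0)"
begin

text \<open>Column i + 1 vanishes in the rows above i, whose only nonzero entries lie further left
  by induction, and on and below the diagonal. So its single entry, in row i, has modulus 1, and
  orthogonality to the other columns clears the rest of row i.\<close>

lemma superdiagonal:
  "Suc i < m \<Longrightarrow> cmod (B i (Suc i)) = 1 \<and> (\<forall>k<n. k \<noteq> Suc i \<longrightarrow> B i k = 0)"
proof (induction i rule: less_induct)
  case (less i)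
  have col: "B l (Suc i) = 0" if l: "l < n" "l \<noteq> i" for l
  proof -
    consider "l < i" | "l = Suc i" | "Suc i < l" using l(2) by arith
    then show ?thesis
    proof cases
      case 1
      then show ?thesis using less.IH[of l] less.prems m_le by auto
    next
      case 2
      then show ?thesis using diag_0 less.prems by simp
    next
      case 3
      then show ?thesis using tri l by simp
    qed
  qed
  have prod: "cnj (B i (Suc i)) * B i k = (if Suc i = k then 1 else 0)" if "k < n" for k
  proof -
    have "(\<Sum>l<n. cnj (B l (Suc i)) * B l k) = (\<Sum>l<n. if l = i then cnj (B i (Suc i)) * B i k else 0)"
      by (rule sum.cong) (auto simp: col)
    also have "\<dots> = cnj (B i (Suc i)) * B i k" using less.prems m_le by simp
    finally show ?thesis using cols[of "Suc i" k] less.prems m_le that by (cases "Suc i = k") auto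
  qed
  have "of_real ((cmod (B i (Suc i)))\<^sup>2) = (1::complex)"
    unfolding complex_norm_square using prod[of "Suc i"] less.prems m_le by (simp add: mult.commute)
  then have "(cmod (B i (Suc i)))\<^sup>2 = 1" using of_real_eq_1_iff by blast
  then have 1: "cmod (B i (Suc i)) = 1" by (simp add: power2_eq_1_iff) (use norm_ge_zero[of "B i (Suc i)"] in linarith)
  moreover have "B i k = 0" if "k < n" "k \<noteq> Suc i" for k
    using prod[OF that(1)] that(2) 1 by auto
  ultimately show ?case by blast
qed

text \<open>The grade of i is \<open>min i m\<close>. Rows before m - 1 contain only their
  superdiagonal entry; row m - 1 is strictly upper triangular, so it reaches only columns of the
  capped grade m; later rows stay there.\<close>

lemma graded:
  assumes "i < n" "j < n" "B i j \<noteq> 0"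
  shows "min j m = Suc (min i m) \<or> m \<le> i \<and> m \<le> j"
proof -
  have ij: "i \<le> j" using tri[OF assms(1), of j] assms(3) by (meson not_le)
  consider "Suc i < m" | "Suc i = m" | "m \<le> i" by linarith
  then show ?thesis
  proof cases
    case 1
    then show ?thesis using superdiagonal[OF 1] assms by auto
  next
    case 2
    then have "i \<noteq> j" using diag_0[of i] assms by auto
    then show ?thesis using ij 2 by auto
  next
    case 3
    then show ?thesis using ij by auto
  qed
qed

lemma sq_app:
  assumes "0 < m" shows "sq n (app n B y) = (\<Sum>j<n. of_bool (0 < j) * (cmod (y j))\<^sup>2)"
  by (rule sq_app_orthogonal_columns) (use cols[OF assms] in simp)

lemma contraction: "0 < m \<Longrightarrow> sq n (app n B y) \<le> sq n y"
  by (simp only: sq_app) (unfold sq_def, intro sum_mono, auto)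

lemma kron_contraction: "0 < m \<Longrightarrow> sq (n*n) (app (n*n) (kron n B) y) \<le> sq (n*n) y"
proof -
  assume m: "0 < m"
  have "sq (n*n) (app (n*n) (kron n B) y)
      = (\<Sum>p<n*n. of_bool (0 < p div n) * of_bool (0 < p mod n) * (cmod (y p))\<^sup>2)"
    by (rule sq_app_orthogonal_columns, rule kron_orthogonal_columns) (use cols[OF m] in auto)
  also have "\<dots> \<le> sq (n*n) y" unfolding sq_def by (intro sum_mono) auto
  finally show ?thesis .
qed

lemma sq_app_isometric: "0 < m \<Longrightarrow> y 0 = 0 \<Longrightarrow> sq n (app n B y) = sq n y"
  by (simp only: sq_app) (unfold sq_def, intro sum.cong refl, auto simp: of_bool_def)

text \<open>The conditions \<open>(B\<^sup>k x)\<^sub>0 = 0\<close> for \<open>k < n - 1\<close> are \<open>n - 1\<close> linear equations in \<open>n\<close> unknowns.\<close>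

lemma isometric_chain:
  assumes m: "0 < m"
  shows "\<exists>x. (\<forall>k i. x (Suc k) i = app n B (x k) i) \<and> (\<forall>k<n. sq n (x k) = 1)"
proof -
  have n: "0 < n" using m m_le by simp
  \<comment> \<open>\<open>R k\<close> is row 0 of the k-th power of B.\<close>
  define R where "R = rec_nat (\<lambda>j. of_bool (j = 0) :: complex) (\<lambda>k r j. \<Sum>l<n. r l * B l j)"
  have R0: "R 0 j = of_bool (j = 0)" and RSuc: "R (Suc k) j = (\<Sum>l<n. R k l * B l j)" for j k
    by (simp_all add: R_def)
  have R: "(app n B ^^ k) x 0 = (\<Sum>j<n. R k j * x j)" for k x
  proof (induction k arbitrary: x)
    case 0
    have "(\<Sum>j<n. R 0 j * x j) = (\<Sum>j<n. if j = 0 then x j else 0)"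
      by (rule sum.cong) (auto simp: R0)
    then show ?case using n by simp
  next
    case (Suc k)
    have "(app n B ^^ Suc k) x 0 = (app n B ^^ k) (app n B x) 0" by (simp only: funpow_Suc_right o_apply)
    also have "\<dots> = (\<Sum>l<n. \<Sum>j<n. R k l * B l j * x j)"
      unfolding Suc.IH by (simp add: app_def sum_distrib_left mult.assoc)
    also have "\<dots> = (\<Sum>j<n. R (Suc k) j * x j)"
      unfolding RSuc sum_distrib_right by (rule sum.swap)
    finally show ?case .
  qed
  \<comment> \<open>The n - 1 equations padded by a zero row to a square system. The transpose kills
    the last unit vector, so the determinant is 0 and a nonzero solution exists.\<close>
  define f where "f k j = (if Suc k < n then R k j else 0)" for k j
  have "det (mat n n (\<lambda>(i, j). f j i)) = 0"
    unfolding det_zero_kernel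
  proof (rule exI[of _ "\<lambda>j. of_bool (j = n - 1)"], rule conjI)
    show "\<exists>i<n. of_bool (i = n - 1) \<noteq> (0::complex)" using n by (intro exI[of _ "n - 1"]) auto
    show "\<forall>i<n. app n (\<lambda>i j. f j i) (\<lambda>j. of_bool (j = n - 1)) i = 0"
      unfolding app_def by (auto simp: f_def intro!: sum.neutral)
  qed
  moreover have "mat n n (\<lambda>(i, j). f j i) = transpose_mat (mat n n (\<lambda>(i, j). f i j))"
    by (rule eq_matI) auto
  ultimately have "det (mat n n (\<lambda>(i, j). f i j)) = 0" using det_transpose[of "mat n n (\<lambda>(i, j). f i j)" n] by simp
  then obtain x where x: "\<exists>i<n. x i \<noteq> 0" and ker: "\<And>k. k < n \<Longrightarrow> app n f x k = 0"
    unfolding det_zero_kernel by blast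
  have pos: "0 < sq n x" using x sq_pos by blast
  define z where "z = (\<lambda>i. of_real (1 / sqrt (sq n x)) * x i)"
  have z1: "sq n z = 1" unfolding z_def sq_scale using pos
    by (simp add: norm_divide power_divide)
  define w where "w k = (app n B ^^ k) z" for k
  have w0: "w k 0 = 0" if "Suc k < n" for k
  proof -
    have "w k 0 = of_real (1 / sqrt (sq n x)) * (\<Sum>j<n. R k j * x j)"
      unfolding w_def R z_def by (simp add: sum_distrib_left mult_ac)
    also have "(\<Sum>j<n. R k j * x j) = app n f x k" using that by (simp add: app_def f_def)
    finally show ?thesis using ker[of k] that by simp
  qed
  have wS: "w (Suc k) = app n B (w k)" for k by (simp add: w_def)
  \<comment> \<open>The step from \<open>w k\<close> to \<open>w (Suc k)\<close> preserves the norm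
    if \<open>w k 0 = 0\<close>; only the n - 1 steps between the n vectors need this.\<close>
  have "sq n (w k) = 1" if "k < n" for k
    using that
  proof (induction k)
    case 0
    then show ?case using z1 by (simp add: w_def)
  next
    case (Suc k)
    then show ?case unfolding wS using sq_app_isometric[of "w k", OF m w0[of k]] by simp
  qed
  then show ?thesis using wS by (intro exI[of _ w]) auto
qed

text \<open>The upper bound on \<rho> comes with m, the lower bound with n; since the cosine
  decreases on [0, pi], they are compatible only if n is at most m. Positivity of m is obtained
  first because \<open>cols\<close>, and with it the isometric chain, depends on it.\<close>

lemma disc_imp_nilpotent:
  assumes bound: "\<And>y. cmod (ip n (app n B y) y) \<le> \<rho> * sq n y"
    and att: "\<And>t. cmod t = 1 \<Longrightarrow> \<exists>x. sq n x = 1 \<and> ip n (app n B x) x = of_real \<rho> * t"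
  shows "m = n"
proof -
  have *: "0 < m \<and> \<rho> \<le> cos (pi / real (m + 1))"
  proof (rule graded_disc_radius_le[OF bound att, where g = "\<lambda>i. min i m"])
    show "min j m = Suc (min i m) \<or> min i m = m \<and> min j m = m" if "i < n" "j < n" "B i j \<noteq> 0" for i j
      using graded[OF that] by auto
    show "B i i \<noteq> 0" if "i < n" "min i m = m" for i using diag that by auto
  qed (use tri contraction in auto)
  then have m: "0 < m" by simp
  obtain x where chain: "\<And>k i. x (Suc k) i = app n B (x k) i" and unit: "\<And>k. k < n \<Longrightarrow> sq n (x k) = 1"
    using isometric_chain[OF m] by blast
  have "cos (pi / real (n + 1)) \<le> \<rho>"
    by (rule chain_lower_bound[OF _ _ unit bound]) (use m m_le chain in auto)
  then have "cos (pi / real (n + 1)) \<le> cos (pi / real (m + 1))" using * by simp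
  then have "pi / real (m + 1) \<le> pi / real (n + 1)"
    by (subst (asm) cos_mono_le_eq) (auto simp: field_simps)
  then have "n \<le> m" by (simp add: field_simps)
  then show ?thesis using m_le by simp
qed

lemma kron_disc_imp_nilpotent:
  assumes bound: "\<And>y. cmod (ip (n*n) (app (n*n) (kron n B) y) y) \<le> \<rho> * sq (n*n) y"
    and att: "\<And>t. cmod t = 1 \<Longrightarrow> \<exists>x. sq (n*n) x = 1 \<and> ip (n*n) (app (n*n) (kron n B) x) x = of_real \<rho> * t"
  shows "m = n"
proof -
  \<comment> \<open>The lesser of the two factor grades: a nonzero entry raises each factor grade by
    one or leaves it at the cap m, so the minimum behaves in the same way. A minimum equal to m puts
    both factors in the invertible part.\<close>
  let ?g = "\<lambda>p. min (min (p div n) (p mod n)) m"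
  have *: "0 < m \<and> \<rho> \<le> cos (pi / real (m + 1))"
  proof (rule graded_disc_radius_le[OF bound att, where g = ?g])
    fix p q assume p: "p < n * n" and q: "q < n * n" and nz: "kron n B p q \<noteq> 0"
    show "?g q = Suc (?g p) \<or> ?g p = m \<and> ?g q = m"
      using graded[OF div_mod_less(1)[OF p] div_mod_less(1)[OF q]]
        graded[OF div_mod_less(2)[OF p] div_mod_less(2)[OF q]] nz
      unfolding kron_def by (auto simp: min_def split: if_splits)
  next
    fix p q assume p: "p < n * n" and qp: "q < p"
    show "kron n B p q = 0"
    proof (rule ccontr)
      assume nz: "kron n B p q \<noteq> 0"
      have "\<not> q div n < p div n" "\<not> q mod n < p mod n"
        using nz tri[OF div_mod_less(1)[OF p]] tri[OF div_mod_less(2)[OF p]] unfolding kron_def by auto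
      \<comment> \<open>The row-major encoding is monotone in both coordinates, so triangularity
        passes to the tensor square.\<close>
      then have "p div n * n + p mod n \<le> q div n * n + q mod n"
        by (intro add_mono mult_right_mono) auto
      then show False using qp by simp
    qed
  next
    fix p assume p: "p < n * n" and "?g p = m"
    then show "kron n B p p \<noteq> 0"
      using diag[of "p div n"] diag[of "p mod n"] div_mod_less[OF p] by (auto simp: kron_def)
  qed (use kron_contraction in auto)
  then have m: "0 < m" by simp
  obtain x where chain: "\<And>k i. x (Suc k) i = app n B (x k) i" and unit: "\<And>k. k < n \<Longrightarrow> sq n (x k) = 1"
    using isometric_chain[OF m] by blast
  have "cos (pi / real (n + 1)) \<le> \<rho>"
  proof (rule chain_lower_bound[OF _ _ _ bound])
    show "0 < n" using m m_le by simp
    show "app (n*n) (kron n B) (\<lambda>p. x k (p div n) * x k (p mod n)) p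
        = x (Suc k) (p div n) * x (Suc k) (p mod n)" for k p
      unfolding app_kron_tensor chain ..
    show "sq (n*n) (\<lambda>p. x k (p div n) * x k (p mod n)) = 1" if "k < n" for k
      unfolding sq_tensor using unit[OF that] by simp
  qed
  then have "cos (pi / real (n + 1)) \<le> cos (pi / real (m + 1))" using * by simp
  then have "pi / real (m + 1) \<le> pi / real (n + 1)"
    by (subst (asm) cos_mono_le_eq) (auto simp: field_simps)
  then have "n \<le> m" by (simp add: field_simps)
  then show ?thesis using m_le by simp
qed

end

subsection \<open>The numerical range of the shift\<close>

definition num_range :: "nat \<Rightarrow> (nat \<Rightarrow> nat \<Rightarrow> complex) \<Rightarrow> complex set" where
  "num_range N M = {ip N (app N M x) x | x. sq N x = 1}"

text \<open>The nilpotent Jordan block with no size attached: \<open>app\<close> and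
  \<open>kron\<close> receive the size themselves.\<close>

definition shift :: "nat \<Rightarrow> nat \<Rightarrow> complex" where
  "shift i j = of_bool (Suc i = j)"

lemma nilpotent_first_shift: "nilpotent_first n n shift"
proof
  fix j k assume j: "j < n" and k: "k < n"
  \<comment> \<open>For j = 0 truncated subtraction yields the index 0, and the factor
    \<open>of_bool (0 < j \<and> j = k)\<close> then makes the term 0.\<close>
  have "(\<Sum>i<n. cnj (shift i j) * shift i k) = (\<Sum>i<n. if i = j - 1 then of_bool (0 < j \<and> j = k) else 0)"
    by (rule sum.cong) (auto simp: shift_def)
  also have "\<dots> = of_bool (0 < j \<and> j = k)" using j by (simp add: less_imp_diff_less)
  finally show "(\<Sum>i<n. cnj (shift i j) * shift i k) = (if j = k then of_bool (0 < j) else 0)" by auto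
qed (auto simp: shift_def)

lemma ip_app_shift: "ip n (app n shift x) x = (\<Sum>i<n. of_bool (Suc i < n) * (x (Suc i) * cnj (x i)))"
  unfolding ip_def
proof (rule sum.cong)
  fix i assume "i \<in> {..<n}"
  have "app n shift x i = (\<Sum>j<n. if j = Suc i then x (Suc i) else 0)"
    unfolding app_def by (rule sum.cong) (auto simp: shift_def)
  then show "app n shift x i * cnj (x i) = of_bool (Suc i < n) * (x (Suc i) * cnj (x i))" by simp
qed simp

text \<open>The weights t^k \<open>s (Suc k)\<close> give the Rayleigh quotient F t / D t, which
  moves continuously from 0 at t = 0 to the cosine at t = 1, so every modulus occurs. The phases u^k
  multiply the value by u and so reach every argument.\<close>

lemma num_range_shift_superset:
  assumes n: "0 < n"
  shows "cball 0 (cos (pi / real (n + 1))) \<subseteq> num_range n shift"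
proof
  fix c :: complex assume "c \<in> cball 0 (cos (pi / real (n + 1)))"
  then have c: "cmod c \<le> cos (pi / real (n + 1))" by simp
  define s where "s = (\<lambda>k. sin (real k * (pi / real (n + 1))))"
  have spos: "0 < s (Suc k)" if "k < n" for k
    using sin_grid_pos[of "Suc k" n] that unfolding s_def by simp
  have sn: "s (Suc n) = 0" by (simp add: s_def)
  define D where "D t = (\<Sum>k<n. (t ^ k * s (Suc k))\<^sup>2)" for t
  define F where "F t = (\<Sum>k<n. t ^ Suc (2 * k) * (s (Suc k) * s (Suc (Suc k))))" for t
  have Dpos: "0 < D t" for t
    unfolding D_def
    by (rule sum_pos2[of _ 0]) (use n spos[of 0] in auto)
  have cont: "continuous_on {0..1} (\<lambda>t. F t / D t)"
    unfolding F_def D_def using Dpos[unfolded D_def] by (intro continuous_intros) (auto simp: less_imp_neq[THEN not_sym])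
  have F1: "F 1 / D 1 = cos (pi / real (n + 1))"
    using sum_adjacent_sin[of n] Dpos[of 1] by (simp add: F_def D_def s_def)
  have "\<exists>t\<ge>0. t \<le> 1 \<and> F t / D t = cmod c"
    by (rule IVT') (use c F1 cont in \<open>auto simp: F_def\<close>)
  then obtain t where t: "0 \<le> t" "F t / D t = cmod c" by blast
  define u where "u = cis (Arg c)"
  define \<alpha> where "\<alpha> = 1 / sqrt (D t)"
  define x where "x k = of_real \<alpha> * (u ^ k * of_real (t ^ k * s (Suc k)))" for k
  have \<alpha>: "\<alpha> * \<alpha> = 1 / D t" using Dpos[of t] by (simp add: \<alpha>_def)
  have u1: "cmod u = 1" by (simp add: u_def)
  have u: "cmod (u ^ k) = 1" for k by (simp add: u1 norm_power)
  have uu: "u ^ Suc k * cnj (u ^ k) = u" for k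
  proof -
    have "u ^ Suc k * cnj (u ^ k) = u * of_real ((cmod (u ^ k))\<^sup>2)"
      unfolding complex_norm_square by (simp add: mult.assoc)
    then show ?thesis using u by simp
  qed
  have "sq n x = \<alpha>\<^sup>2 * D t"
    unfolding x_def sq_scale using t(1) by (simp add: sq_def D_def norm_mult u1 power_mult_distrib norm_power)
  then have "sq n x = 1" using \<alpha> Dpos[of t] by (simp add: power2_eq_square)
  moreover have "ip n (app n shift x) x = c"
  proof -
    have "ip n (app n shift x) x = (\<Sum>k<n. u * of_real (\<alpha> * \<alpha> * (t ^ Suc (2 * k) * (s (Suc k) * s (Suc (Suc k))))))"
      unfolding ip_app_shift
    proof (rule sum.cong)
      fix k assume k: "k \<in> {..<n}"
      have "x (Suc k) * cnj (x k) = (u ^ Suc k * cnj (u ^ k)) * of_real (\<alpha> * \<alpha> * (t ^ Suc k * t ^ k * (s (Suc k) * s (Suc (Suc k)))))"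
        by (simp add: x_def mult_ac)
      also have "t ^ Suc k * t ^ k = t ^ Suc (2 * k)" by (simp add: power_add[symmetric] mult_2)
      finally have *: "x (Suc k) * cnj (x k) = u * of_real (\<alpha> * \<alpha> * (t ^ Suc (2 * k) * (s (Suc k) * s (Suc (Suc k)))))"
        unfolding uu .
      show "of_bool (Suc k < n) * (x (Suc k) * cnj (x k)) = u * of_real (\<alpha> * \<alpha> * (t ^ Suc (2 * k) * (s (Suc k) * s (Suc (Suc k)))))"
        unfolding * using sn k by (cases "Suc k = n") auto
    qed simp
    also have "\<dots> = u * of_real (\<alpha> * \<alpha> * F t)"
      unfolding F_def by (simp only: sum_distrib_left of_real_sum of_real_mult)
    also have "\<alpha> * \<alpha> * F t = cmod c" unfolding \<alpha> using t(2) by simp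
    also have "u * of_real (cmod c) = c"
      using rcis_cmod_Arg[of c] by (simp add: u_def rcis_def mult.commute)
    finally show ?thesis .
  qed
  ultimately show "c \<in> num_range n shift" unfolding num_range_def by blast
qed

text \<open>The diagonal vectors, combinations of e_i tensor e_i, form an invariant subspace on
  which the tensor square acts as the shift itself; y is x carried over to it.\<close>

lemma num_range_subset_kron_shift: "num_range n shift \<subseteq> num_range (n*n) (kron n shift)"
proof
  fix c assume "c \<in> num_range n shift"
  then obtain x where x: "sq n x = 1" "ip n (app n shift x) x = c" unfolding num_range_def by blast
  define y where "y p = of_bool (p div n = p mod n) * x (p div n)" for p
  have sum1: "(\<Sum>j<n. of_bool (i = j) * f j) = f i" if "i < n" for i and f :: "nat \<Rightarrow> 'a :: semiring_1"
  proof -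
    have "(\<Sum>j<n. of_bool (i = j) * f j) = (\<Sum>j<n. if j = i then f i else 0)"
      by (rule sum.cong) auto
    then show ?thesis using that by simp
  qed
  have "sq (n*n) y = (\<Sum>i<n. \<Sum>j<n. of_bool (i = j) * (cmod (x i))\<^sup>2)"
    unfolding sq_def y_def sum_div_mod[symmetric] by (rule sum.cong) auto
  then have "sq (n*n) y = 1" using x(1) sum1 by (simp add: sq_def)
  moreover have "app (n*n) (kron n shift) y p = of_bool (p div n = p mod n) * app n shift x (p div n)"
    if p: "p < n * n" for p
  proof -
    have "app (n*n) (kron n shift) y p =
      (\<Sum>k<n. \<Sum>l<n. shift (p div n) k * shift (p mod n) l * (of_bool (k = l) * x k))"
      unfolding app_def kron_def y_def
      by (rule sum_div_mod[of "\<lambda>k l. shift (p div n) k * shift (p mod n) l * (of_bool (k = l) * x k)"])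
    also have "\<dots> = (\<Sum>k<n. \<Sum>l<n. of_bool (k = l) * (shift (p div n) k * shift (p mod n) l * x k))"
      by (intro sum.cong refl) (simp only: mult_ac)
    also have "\<dots> = (\<Sum>k<n. shift (p div n) k * shift (p mod n) k * x k)"
      by (intro sum.cong refl sum1) simp
    also have "\<dots> = (\<Sum>k<n. of_bool (p div n = p mod n) * (shift (p div n) k * x k))"
      by (rule sum.cong) (auto simp: shift_def)
    finally show ?thesis by (simp add: app_def sum_distrib_left)
  qed
  then have "ip (n*n) (app (n*n) (kron n shift) y) y =
      (\<Sum>p<n*n. of_bool (p div n = p mod n) * (app n shift x (p div n) * cnj (x (p div n))))"
    unfolding ip_def y_def by (intro sum.cong refl) auto
  then have "ip (n*n) (app (n*n) (kron n shift) y) y =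
      (\<Sum>i<n. \<Sum>j<n. of_bool (i = j) * (app n shift x i * cnj (x i)))"
    using sum_div_mod[of "\<lambda>i j. of_bool (i = j) * (app n shift x i * cnj (x i))" n] by metis
  then have "ip (n*n) (app (n*n) (kron n shift) y) y = c" using sum1 x(2) by (simp add: ip_def)
  ultimately show "c \<in> num_range (n*n) (kron n shift)" unfolding num_range_def by blast
qed

text \<open>The tensor square raises both indices by one, hence also their minimum, which takes only
  the n values below n; so the bound has n + 1 and not n^2 + 1.\<close>

lemma num_range_kron_shift_subset:
  assumes n: "0 < n"
  shows "num_range (n*n) (kron n shift) \<subseteq> cball 0 (cos (pi / real (n + 1)))"
proof
  fix c assume "c \<in> num_range (n*n) (kron n shift)"
  then obtain x where x: "sq (n*n) x = 1" "ip (n*n) (app (n*n) (kron n shift) x) x = c"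
    unfolding num_range_def by blast
  have "cmod (ip (n*n) (app (n*n) (kron n shift) x) x) \<le> cos (pi / real (n + 1)) * sq (n*n) x"
  proof (rule block_shift_bound[where g = "\<lambda>p. min (p div n) (p mod n)"])
    show "sq (n*n) (app (n*n) (kron n shift) y) \<le> sq (n*n) y" for y
      by (rule nilpotent_first.kron_contraction[OF nilpotent_first_shift n])
    show "min (q div n) (q mod n) = Suc (min (p div n) (p mod n))" if "kron n shift p q \<noteq> 0" for p q
      using that by (auto simp: kron_def shift_def)
    show "min (p div n) (p mod n) < n" for p using n by (simp add: min.strict_coboundedI2)
  qed
  then show "c \<in> cball 0 (cos (pi / real (n + 1)))" using x by simp
qed

text \<open>A cycle of inclusions: disc, range of the shift, range of its tensor square,
  disc.\<close>

lemma num_range_shift: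
  assumes "0 < n"
  shows "num_range n shift = cball 0 (cos (pi / real (n + 1)))"
    and "num_range (n*n) (kron n shift) = cball 0 (cos (pi / real (n + 1)))"
  using num_range_shift_superset[OF assms] num_range_subset_kron_shift[of n]
    num_range_kron_shift_subset[OF assms] by blast+

subsection \<open>Unitary similarity\<close>

definition ent :: "complex mat \<Rightarrow> nat \<Rightarrow> nat \<Rightarrow> complex" where
  "ent A i j = A $$ (i, j)"

lemma num_range_cong:
  assumes "\<And>i j. i < N \<Longrightarrow> j < N \<Longrightarrow> M i j = M' i j"
  shows "num_range N M = num_range N M'"
proof -
  have "ip N (app N M x) x = ip N (app N M' x) x" for x
    using assms by (intro ip_cong) (auto simp: app_def)
  then show ?thesis by (simp add: num_range_def)
qed

lemma numerical_range_eq_num_range: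
  assumes A: "A \<in> carrier_mat N N"
  shows "numerical_range A = num_range N (ent A)"
proof -
  have form: "(A *\<^sub>v x) \<bullet>c x = ip N (app N (ent A) (($) x)) (($) x)" if "x \<in> carrier_vec N" for x
    using A that by (auto simp: scalar_prod_def ip_def app_def ent_def atLeast0LessThan intro!: sum.cong)
  have norm: "cvec_norm x = 1 \<longleftrightarrow> sq N (($) x) = 1" if "x \<in> carrier_vec N" for x
  proof -
    have "x \<bullet>c x = ip N (($) x) (($) x)"
      using that by (auto simp: scalar_prod_def ip_def atLeast0LessThan intro!: sum.cong)
    then show ?thesis by (simp add: cvec_norm_def ip_self)
  qed
  show ?thesis
  proof (intro equalityI subsetI)
    fix c assume "c \<in> numerical_range A"
    then obtain x where x: "c = (A *\<^sub>v x) \<bullet>c x" "x \<in> carrier_vec N" "cvec_norm x = 1"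
      using A unfolding numerical_range_def by auto
    then show "c \<in> num_range N (ent A)" unfolding num_range_def using form norm by auto
  next
    fix c assume "c \<in> num_range N (ent A)"
    then obtain f where f: "c = ip N (app N (ent A) f) f" "sq N f = 1" unfolding num_range_def by auto
    define x where "x = vec N f"
    have x: "x \<in> carrier_vec N" by (simp add: x_def)
    have xf: "x $ i = f i" if "i < N" for i using that by (simp add: x_def)
    have "c = ip N (app N (ent A) (($) x)) (($) x)"
      unfolding f(1) by (intro ip_cong app_cong) (auto simp: xf)
    moreover have "sq N (($) x) = 1" using f(2) sq_cong[of N "($) x" f] xf by simp
    ultimately show "c \<in> numerical_range A"
      using x form[OF x] norm[OF x] A unfolding numerical_range_def by (auto intro!: exI[of _ x])
  qed
qed

lemma kronecker_mat_carrier: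
  "A \<in> carrier_mat n n \<Longrightarrow> kronecker_mat A A \<in> carrier_mat (n*n) (n*n)"
  by (auto simp: kronecker_mat_def)

lemma numerical_range_kronecker_mat:
  assumes A: "A \<in> carrier_mat n n"
  shows "numerical_range (kronecker_mat A A) = num_range (n*n) (kron n (ent A))"
  unfolding numerical_range_eq_num_range[OF kronecker_mat_carrier[OF A]]
  by (rule num_range_cong) (use A in \<open>auto simp: ent_def kron_def kronecker_mat_def\<close>)

text \<open>With z = U^* x the form of A at x is the form of B at z, and z is a unit vector because
  U U^* = 1. The reverse inclusion comes from symmetry of unitary similarity.\<close>

lemma num_range_unitary_subset:
  assumes A: "\<And>i j. i < N \<Longrightarrow> j < N \<Longrightarrow> A i j = (\<Sum>k<N. \<Sum>l<N. U i k * B k l * cnj (U j l))"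
    and rows: "\<And>i j. i < N \<Longrightarrow> j < N \<Longrightarrow> (\<Sum>k<N. U i k * cnj (U j k)) = of_bool (i = j)"
  shows "num_range N A \<subseteq> num_range N B"
proof
  fix c assume "c \<in> num_range N A"
  then obtain x where x: "c = ip N (app N A x) x" "sq N x = 1" unfolding num_range_def by blast
  define z where "z = app N (\<lambda>l j. cnj (U j l)) x"
  have "sq N z = (\<Sum>j<N. 1 * (cmod (x j))\<^sup>2)"
    unfolding z_def by (rule sq_app_orthogonal_columns) (simp add: rows)
  then have z1: "sq N z = 1" using x(2) by (simp add: sq_def)
  have "app N A x i = app N U (app N B z) i" if i: "i < N" for i
  proof -
    have "app N U (app N B z) i = (\<Sum>k<N. \<Sum>l<N. \<Sum>j<N. U i k * B k l * cnj (U j l) * x j)"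
      by (simp add: app_def z_def sum_distrib_left mult.assoc)
    also have "\<dots> = (\<Sum>k<N. \<Sum>j<N. \<Sum>l<N. U i k * B k l * cnj (U j l) * x j)"
      by (intro sum.cong refl sum.swap)
    also have "\<dots> = (\<Sum>j<N. \<Sum>k<N. \<Sum>l<N. U i k * B k l * cnj (U j l) * x j)"
      by (rule sum.swap)
    also have "\<dots> = app N A x i"
      unfolding app_def using A[OF i] by (simp add: sum_distrib_right)
    finally show ?thesis ..
  qed
  then have "c = ip N (app N U (app N B z)) x" unfolding x(1) by (intro ip_cong) auto
  also have "\<dots> = ip N (app N B z) z" unfolding ip_app_adjoint z_def ..
  finally show "c \<in> num_range N B" unfolding num_range_def using z1 by blast
qed

text \<open>\<open>kron n U\<close> has orthonormal rows and carries out the similarity of the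
  tensor squares; sums over pairs factor by \<open>sum_div_mod_product\<close>.\<close>

lemma num_range_kron_unitary_subset:
  assumes A: "\<And>i j. i < n \<Longrightarrow> j < n \<Longrightarrow> A i j = (\<Sum>k<n. \<Sum>l<n. U i k * B k l * cnj (U j l))"
    and rows: "\<And>i j. i < n \<Longrightarrow> j < n \<Longrightarrow> (\<Sum>k<n. U i k * cnj (U j k)) = of_bool (i = j)"
  shows "num_range (n*n) (kron n A) \<subseteq> num_range (n*n) (kron n B)"
proof (rule num_range_unitary_subset[where U = "kron n U"])
  fix p q assume p: "p < n * n" and q: "q < n * n"
  let ?T = "\<lambda>i j k l. U i k * B k l * cnj (U j l)"
  have "kron n A p q = (\<Sum>k<n. \<Sum>l<n. ?T (p div n) (q div n) k l) * (\<Sum>k<n. \<Sum>l<n. ?T (p mod n) (q mod n) k l)"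
    unfolding kron_def using A div_mod_less[OF p] div_mod_less[OF q] by simp
  also have "\<dots> = (\<Sum>r<n*n. (\<Sum>l<n. ?T (p div n) (q div n) (r div n) l) * (\<Sum>l<n. ?T (p mod n) (q mod n) (r mod n) l))"
    by (rule sum_div_mod_product[symmetric])
  also have "\<dots> = (\<Sum>r<n*n. \<Sum>s<n*n. ?T (p div n) (q div n) (r div n) (s div n) * ?T (p mod n) (q mod n) (r mod n) (s mod n))"
    by (intro sum.cong refl sum_div_mod_product[symmetric])
  also have "\<dots> = (\<Sum>r<n*n. \<Sum>s<n*n. kron n U p r * kron n B r s * cnj (kron n U q s))"
    unfolding kron_def by (intro sum.cong refl) (simp add: mult_ac)
  finally show "kron n A p q = (\<Sum>r<n*n. \<Sum>s<n*n. kron n U p r * kron n B r s * cnj (kron n U q s))" .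
  have "(\<Sum>r<n*n. kron n U p r * cnj (kron n U q r)) =
     (\<Sum>r<n*n. (U (p div n) (r div n) * cnj (U (q div n) (r div n))) * (U (p mod n) (r mod n) * cnj (U (q mod n) (r mod n))))"
    unfolding kron_def by (intro sum.cong refl) (simp add: mult_ac)
  also have "\<dots> = (\<Sum>k<n. U (p div n) k * cnj (U (q div n) k)) * (\<Sum>k<n. U (p mod n) k * cnj (U (q mod n) k))"
    by (rule sum_div_mod_product)
  also have "\<dots> = of_bool (p div n = q div n \<and> p mod n = q mod n)"
    using rows div_mod_less[OF p] div_mod_less[OF q] by simp
  finally have "(\<Sum>r<n*n. kron n U p r * cnj (kron n U q r)) = of_bool (p div n = q div n \<and> p mod n = q mod n)" .
  moreover have "(p div n = q div n \<and> p mod n = q mod n) = (p = q)" by (metis div_mult_mod_eq)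
  ultimately show "(\<Sum>r<n*n. kron n U p r * cnj (kron n U q r)) = of_bool (p = q)" by (simp only:)
qed

section \<open>Adjoints and unitary similarity of matrices\<close>

lemma mat_adjoint_index [simp]:
  fixes A :: "complex mat"
  shows "i < dim_col A \<Longrightarrow> j < dim_row A \<Longrightarrow> mat_adjoint A $$ (i, j) = cnj (A $$ (j, i))"
    and "dim_row (mat_adjoint A) = dim_col A" "dim_col (mat_adjoint A) = dim_row A"
  by (auto simp: mat_adjoint_def mat_of_rows_def)

lemma mat_adjoint_carrier [simp]:
  "(A :: complex mat) \<in> carrier_mat n m \<Longrightarrow> mat_adjoint A \<in> carrier_mat m n"
  by (intro carrier_matI) auto

lemma mat_adjoint_adjoint [simp]: "mat_adjoint (mat_adjoint A) = (A :: complex mat)"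
  by (rule eq_matI) auto

lemma mat_adjoint_mult:
  assumes "A \<in> carrier_mat n m" "B \<in> carrier_mat m k"
  shows "mat_adjoint (A * B) = mat_adjoint B * mat_adjoint (A :: complex mat)"
  by (rule eq_matI) (use assms in \<open>auto simp: scalar_prod_def mult.commute intro!: sum.cong\<close>)

lemma unitarily_similar_sym: "unitarily_similar A B \<Longrightarrow> unitarily_similar B A"
  unfolding unitarily_similar_def using similar_mat_wit_sym mat_adjoint_adjoint by metis

lemma unitarily_similar_trans:
  assumes "unitarily_similar A B" "unitarily_similar B C"
  shows "unitarily_similar A C"
proof -
  obtain U V where U: "similar_mat_wit A B U (mat_adjoint U)" and V: "similar_mat_wit B C V (mat_adjoint V)"
    using assms unfolding unitarily_similar_def by blast
  define n where "n = dim_row A"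
  have c: "B \<in> carrier_mat n n" "U \<in> carrier_mat n n" using similar_mat_witD[OF n_def U] by auto
  have "V \<in> carrier_mat n n" using similar_mat_witD2[OF c(1) V] by auto
  then have "mat_adjoint (U * V) = mat_adjoint V * mat_adjoint U" using c mat_adjoint_mult by blast
  then show ?thesis using similar_mat_wit_trans[OF U V] unfolding unitarily_similar_def by metis
qed

lemma unitarily_similar_carrier:
  assumes "unitarily_similar A B" "A \<in> carrier_mat n n"
  shows "B \<in> carrier_mat n n"
  using assms similar_mat_witD2(5) unfolding unitarily_similar_def by blast

lemma unitarily_similar_entries:
  assumes "unitarily_similar A B" "A \<in> carrier_mat n n"
  shows "\<exists>U.
    (\<forall>i<n. \<forall>j<n. ent A i j = (\<Sum>k<n. \<Sum>l<n. U i k * ent B k l * cnj (U j l))) \<and>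
    (\<forall>i<n. \<forall>j<n. (\<Sum>k<n. U i k * cnj (U j k)) = of_bool (i = j))"
proof -
  obtain U where U: "similar_mat_wit A B U (mat_adjoint U)"
    using assms(1) unfolding unitarily_similar_def by blast
  note D = similar_mat_witD2[OF assms(2) U]
  have "ent A i j = (\<Sum>k<n. \<Sum>l<n. ent U i k * ent B k l * cnj (ent U j l))" if "i < n" "j < n" for i j
  proof -
    have "ent A i j = (\<Sum>l<n. (\<Sum>k<n. ent U i k * ent B k l) * cnj (ent U j l))"
      unfolding D(3) using that D(4-7) by (auto simp: ent_def scalar_prod_def atLeast0LessThan intro!: sum.cong)
    also have "\<dots> = (\<Sum>k<n. \<Sum>l<n. ent U i k * ent B k l * cnj (ent U j l))"
      unfolding sum_distrib_right by (rule sum.swap)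
    finally show ?thesis .
  qed
  moreover have "(\<Sum>k<n. ent U i k * cnj (ent U j k)) = of_bool (i = j)" if "i < n" "j < n" for i j
  proof -
    have "(U * mat_adjoint U) $$ (i, j) = (\<Sum>k<n. ent U i k * cnj (ent U j k))"
      using that D(6) by (auto simp: ent_def scalar_prod_def atLeast0LessThan intro!: sum.cong)
    then show ?thesis unfolding D(1) using that by (simp add: of_bool_def)
  qed
  ultimately show ?thesis by blast
qed

lemma unitarily_similar_numerical_range:
  assumes A: "A \<in> carrier_mat n n" and sim: "unitarily_similar A B"
  shows "numerical_range A = num_range n (ent B)"
    and "numerical_range (kronecker_mat A A) = num_range (n*n) (kron n (ent B))"
proof -
  have sub: "num_range n (ent A) \<subseteq> num_range n (ent B) \<and>
      num_range (n*n) (kron n (ent A)) \<subseteq> num_range (n*n) (kron n (ent B))"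
    if AB: "A \<in> carrier_mat n n" "unitarily_similar A B" for A B
  proof -
    obtain U where U:
      "\<forall>i<n. \<forall>j<n. ent A i j = (\<Sum>k<n. \<Sum>l<n. U i k * ent B k l * cnj (U j l))"
      "\<forall>i<n. \<forall>j<n. (\<Sum>k<n. U i k * cnj (U j k)) = of_bool (i = j)"
      using unitarily_similar_entries[OF AB(2,1)] by blast
    show ?thesis
      using num_range_unitary_subset[of n "ent A" U "ent B"] num_range_kron_unitary_subset[of n "ent A" U "ent B"] U
      by simp
  qed
  have B: "B \<in> carrier_mat n n" using unitarily_similar_carrier[OF sim A] .
  have eq: "num_range n (ent A) = num_range n (ent B)"
    "num_range (n*n) (kron n (ent A)) = num_range (n*n) (kron n (ent B))"
    using sub[OF A sim] sub[OF B unitarily_similar_sym[OF sim]] by blast+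
  show "numerical_range A = num_range n (ent B)"
    unfolding numerical_range_eq_num_range[OF A] eq ..
  show "numerical_range (kronecker_mat A A) = num_range (n*n) (kron n (ent B))"
    unfolding numerical_range_kronecker_mat[OF A] eq ..
qed

subsection \<open>Unitary triangularization\<close>

text \<open>A maximal independent set of columns has one element u, so every column is a multiple of
  u. The explicit factors are easy to carry through a unitary similarity.\<close>

lemma rank_one_product_entries:
  fixes R :: "complex mat"
  assumes R: "R \<in> carrier_mat n n" and rank: "vec_space.rank n R = 1"
  shows "\<exists>a b. \<forall>i<n. \<forall>j<n. R $$ (i, j) = a i * b j"
proof -
  interpret vec_space "TYPE(complex)" n .
  have cols: "set (cols R) \<subseteq> carrier_vec n" using cols_dim[of R] R by auto
  let ?P = "\<lambda>T. T \<subseteq> set (cols R) \<and> lin_indpt T"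
  obtain S where S: "finite S" "maximal S ?P"
    using maximal_exists_superset[of "set (cols R)" ?P "{}"] by (auto simp: lin_dep_def)
  have "card S = 1" using rank_card_indpt[OF R S(2)] rank by simp
  then obtain u where u: "S = {u}" by (auto simp: card_1_singleton_iff)
  have Su: "{u} \<subseteq> set (cols R)" "lin_indpt {u}" using S(2) unfolding u maximal_def by auto
  then have uc: "u \<in> carrier_vec n" using cols by auto
  have "\<exists>c. \<forall>i<n. R $$ (i, j) = u $ i * c" if j: "j < n" for j
  proof -
    have colj: "col R j \<in> set (cols R)" using R j by (auto simp: cols_def)
    then have cc: "col R j \<in> carrier_vec n" using cols by auto
    have "col R j \<in> span {u}"
    proof (cases "col R j = u")
      case True
      then show ?thesis using uc in_own_span[of "{u}"] by auto
    next
      case False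
      have "lin_dep (insert (col R j) {u})"
        using S(2) False colj Su unfolding u maximal_def by blast
      then show ?thesis
        using lin_dep_iff_in_span[of "{u}" "col R j"] uc cc Su(2) False by auto
    qed
    then obtain c where c: "lincomb c {u} = col R j" using finite_in_span[of "{u}" "col R j"] uc by auto
    have "lincomb c {u} = c u \<cdot>\<^sub>v u" using uc by (simp add: lincomb_def)
    then have "R $$ (i, j) = u $ i * c u" if "i < n" for i
      using c[symmetric] that j R uc index_col[of i R j] by (simp add: mult.commute)
    then show ?thesis by blast
  qed
  then obtain b where "\<forall>j<n. \<forall>i<n. R $$ (i, j) = u $ i * b j" by metis
  then show ?thesis by blast
qed

text \<open>Householder reflection in the hyperplane orthogonal to \<open>v - e\<^sub>0\<close>; for \<open>v = e\<^sub>0\<close> the division by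
  zero makes it the identity.\<close>

lemma unitary_first_column:
  assumes n: "0 < n" and v1: "sq n v = 1" and v0: "Im (v 0) = 0"
  shows "\<exists>W \<in> carrier_mat n n. W * mat_adjoint W = 1\<^sub>m n \<and> mat_adjoint W * W = 1\<^sub>m n \<and>
    (\<forall>i<n. W $$ (i, 0) = v i)"
proof -
  define w where "w i = v i - of_bool (i = 0)" for i
  define S where "S = sq n w"
  define h where "h i j = of_bool (i = j) - 2 * w i * cnj (w j) / of_real S" for i j
  define W where "W = mat n n (\<lambda>(i, j). h i j)"
  have w0: "w 0 = of_real (Re (v 0) - 1)" using v0 by (simp add: w_def complex_eq_iff)
  have e0: "(\<Sum>i<n. of_bool (i = 0) * f i) = f 0" for f :: "nat \<Rightarrow> complex"
  proof -
    have "(\<Sum>i<n. of_bool (i = 0) * f i) = (\<Sum>i<n. if i = 0 then f 0 else 0)"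
      by (rule sum.cong) auto
    then show ?thesis using n by simp
  qed
  have "of_real S = (\<Sum>i<n. w i * cnj (w i))" unfolding S_def ip_self[symmetric] ip_def ..
  also have "\<dots> = (\<Sum>i<n. v i * cnj (v i) - of_bool (i = 0) * (v i + cnj (v i)) + of_bool (i = 0) * 1)"
    by (rule sum.cong) (auto simp: w_def algebra_simps)
  also have "\<dots> = ip n v v - (v 0 + cnj (v 0)) + 1"
    unfolding sum.distrib sum_subtractf e0 by (simp add: ip_def)
  also have "\<dots> = of_real (2 - 2 * Re (v 0))" using v0 by (simp add: ip_self v1 complex_eq_iff)
  finally have S: "S = 2 - 2 * Re (v 0)" using of_real_eq_iff by blast
  have w_zero: "\<forall>i<n. w i = 0" if "S = 0" using that unfolding S_def sq_eq_0_iff .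
  have first: "h i 0 = v i" if i: "i < n" for i
  proof (cases "S = 0")
    case True
    then show ?thesis using w_zero i by (simp add: h_def w_def of_bool_def split: if_splits)
  next
    case False
    \<comment> \<open>As \<open>v 0\<close> is real, \<open>w 0\<close> is real too, and S = -2
      \<open>w 0\<close>. Hence the reflection adds exactly w to the unit vector e_0 in its first
      column.\<close>
    have "w 0 = - of_real S / 2" unfolding w0 S by simp
    then have "h i 0 = of_bool (i = 0) + w i" using False by (simp add: h_def)
    then show ?thesis by (simp add: w_def)
  qed
  have herm: "cnj (h j i) = h i j" for i j by (auto simp: h_def)
  have hh: "(\<Sum>k<n. h i k * h k j) = of_bool (i = j)" if i: "i < n" and j: "j < n" for i j
  proof (cases "S = 0")
    case True
    have "(\<Sum>k<n. h i k * h k j) = (\<Sum>k<n. if k = i then of_bool (i = j) else 0)"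
      by (rule sum.cong) (auto simp: h_def True)
    then show ?thesis using i by simp
  next
    case False
    have d: "(\<Sum>k<n. of_bool (i = k) * f k) = f i" if "i < n" for f :: "nat \<Rightarrow> complex" and i
    proof -
      have "(\<Sum>k<n. of_bool (i = k) * f k) = (\<Sum>k<n. if k = i then f i else 0)"
        by (rule sum.cong) auto
      then show ?thesis using that by simp
    qed
    define c where "c = 2 / complex_of_real S"
    have "(\<Sum>k<n. h i k * h k j) = (\<Sum>k<n. of_bool (i = k) * h k j -
        (of_bool (j = k) * (c * w i * cnj (w k)) - c * c * w i * cnj (w j) * (w k * cnj (w k))))"
      by (rule sum.cong) (auto simp: h_def c_def algebra_simps)
    also have "\<dots> = h i j - (c * w i * cnj (w j) - c * c * w i * cnj (w j) * ip n w w)"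
      unfolding sum_subtractf d[OF i] d[OF j] sum_distrib_left[symmetric] ip_def ..
    also have "c * c * w i * cnj (w j) * ip n w w = 2 * (c * w i * cnj (w j))"
      unfolding ip_self S_def[symmetric] c_def using False by simp
    finally show ?thesis by (simp add: h_def c_def)
  qed
  have adj: "mat_adjoint W = W" by (rule eq_matI) (auto simp: W_def herm)
  have "W * W = 1\<^sub>m n"
    by (rule eq_matI) (auto simp: W_def scalar_prod_def atLeast0LessThan hh)
  then show ?thesis using adj first n by (intro bexI[of _ W]) (auto simp: W_def)
qed

text \<open>Choosing the eigenvalue 0 whenever it is available is what puts the zeros first in the
  triangularization.\<close>

lemma eigenvector_zero_preferred:
  assumes A: "(A :: complex mat) \<in> carrier_mat n n" and n: "0 < n"
  shows "\<exists>e v. v \<in> carrier_vec n \<and> v \<noteq> 0\<^sub>v n \<and> A *\<^sub>v v = e \<cdot>\<^sub>v v \<and> (det A = 0 \<longrightarrow> e = 0)"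
proof (cases "det A = 0")
  case True
  then obtain v where v: "v \<in> carrier_vec n" "v \<noteq> 0\<^sub>v n" "A *\<^sub>v v = 0\<^sub>v n"
    unfolding det_0_iff_vec_prod_zero_field[OF A] by blast
  then have "A *\<^sub>v v = 0 \<cdot>\<^sub>v v" by auto
  with v show ?thesis by blast
next
  case False
  obtain e where "eigenvalue A e" using spectrum_non_empty[OF A n] by (auto simp: spectrum_def)
  then show ?thesis using False A unfolding eigenvalue_def eigenvector_def by auto
qed

text \<open>Conjugation by a unitary W whose first column is a unit eigenvector: A W e_0 = e W e_0,
  so W^* A W maps e_0 to e times e_0.\<close>

lemma unitarily_similar_eigen_first:
  assumes A: "A \<in> carrier_mat n n" and n: "0 < n"
  shows "\<exists>A' e. A' \<in> carrier_mat n n \<and> unitarily_similar A A' \<and> (\<forall>i<n. A' $$ (i, 0) = (if i = 0 then e else 0))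
    \<and> (det A = 0 \<longrightarrow> e = 0)"
proof -
  obtain e v where v: "v \<in> carrier_vec n" "v \<noteq> 0\<^sub>v n" "A *\<^sub>v v = e \<cdot>\<^sub>v v" and e: "det A = 0 \<longrightarrow> e = 0"
    using eigenvector_zero_preferred[OF A n] by blast
  define s where "s = sq n (($) v)"
  have "\<exists>i<n. v $ i \<noteq> 0" using v(1,2) by (metis carrier_vecD eq_vecI index_zero_vec)
  then have s: "0 < s" unfolding s_def using sq_pos[of _ n "($) v"] by blast
  \<comment> \<open>Besides normalizing, the phase makes entry 0 real, as
    \<open>unitary_first_column\<close> demands.\<close>
  define c where "c = cis (- Arg (v $ 0)) / of_real (sqrt s)"
  define x where "x i = c * v $ i" for i
  have "cmod c = 1 / sqrt s" unfolding c_def norm_divide by simp (use s in simp)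
  then have "sq n x = 1" unfolding x_def sq_scale s_def[symmetric] using s by (simp add: power_divide)
  moreover have "Im (x 0) = 0"
  proof -
    have "cis (- Arg (v $ 0)) * v $ 0 = of_real (cmod (v $ 0))"
      by (metis (no_types) cis_mult cis_zero mult.assoc mult.commute mult.right_neutral neg_eq_iff_add_eq_0 rcis_cmod_Arg rcis_def add.commute)
    then have "x 0 = of_real (cmod (v $ 0) / sqrt s)" by (simp add: x_def c_def)
    then show ?thesis by simp
  qed
  ultimately obtain W where W: "W \<in> carrier_mat n n" "W * mat_adjoint W = 1\<^sub>m n" "mat_adjoint W * W = 1\<^sub>m n"
    and W0: "\<forall>i<n. W $$ (i, 0) = x i"
    using unitary_first_column[OF n] by blast
  define A' where "A' = mat_adjoint W * A * W"
  note aW = mat_adjoint_carrier[OF W(1)]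
  have A': "A' \<in> carrier_mat n n" unfolding A'_def using W(1) aW A by (meson mult_carrier_mat)
  have "W * A' * mat_adjoint W = (W * mat_adjoint W) * A * (W * mat_adjoint W)"
    unfolding A'_def using W(1) aW A by (simp add: assoc_mult_mat[of _ n n _ n _ n] del: mat_adjoint_carrier)
  also have "\<dots> = A" unfolding W(2) using A by simp
  finally have "A = W * A' * mat_adjoint W" ..
  then have "similar_mat_wit A A' W (mat_adjoint W)"
    by (intro similar_mat_witI[OF W(2,3) _ A A' W(1) aW])
  then have sim: "unitarily_similar A A'" unfolding unitarily_similar_def by blast
  have AW: "(A * W) $$ (i, 0) = e * W $$ (i, 0)" if i: "i < n" for i
  proof -
    have "(A * W) $$ (i, 0) = (\<Sum>j<n. A $$ (i, j) * (c * v $ j))"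
      using A W i n W0 by (auto simp: scalar_prod_def atLeast0LessThan x_def intro!: sum.cong)
    also have "\<dots> = c * (A *\<^sub>v v) $ i"
      using A v(1) i by (auto simp: scalar_prod_def atLeast0LessThan sum_distrib_left mult_ac intro!: sum.cong)
    also have "\<dots> = e * W $$ (i, 0)" unfolding v(3) using i v(1) W0 by (simp add: x_def)
    finally show ?thesis .
  qed
  have "A' $$ (i, 0) = (if i = 0 then e else 0)" if i: "i < n" for i
  proof -
    have "A' = mat_adjoint W * (A * W)" unfolding A'_def using assoc_mult_mat[OF aW A W(1)] .
    then have "A' $$ (i, 0) = (\<Sum>j<n. mat_adjoint W $$ (i, j) * (A * W) $$ (j, 0))"
      using A W(1) aW i n by (auto simp: scalar_prod_def atLeast0LessThan intro!: sum.cong)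
    also have "\<dots> = e * (\<Sum>j<n. mat_adjoint W $$ (i, j) * W $$ (j, 0))"
      by (simp add: AW sum_distrib_left mult_ac)
    also have "(\<Sum>j<n. mat_adjoint W $$ (i, j) * W $$ (j, 0)) = (mat_adjoint W * W) $$ (i, 0)"
      using W(1) aW i n by (auto simp: scalar_prod_def atLeast0LessThan intro!: sum.cong)
    finally show ?thesis unfolding W(3) using i n by simp
  qed
  then show ?thesis using A' sim e by blast
qed

lemma unitarily_similar_refl: "A \<in> carrier_mat n n \<Longrightarrow> unitarily_similar A A"
proof -
  assume "A \<in> carrier_mat n n"
  moreover have "mat_adjoint (1\<^sub>m n) = (1\<^sub>m n :: complex mat)" by (rule eq_matI) auto
  ultimately show ?thesis using similar_mat_wit_refl[of A n] unfolding unitarily_similar_def by metis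
qed

text \<open>Conjugation by the block diagonal unitary diag(1, P) leaves the first block alone and
  only multiplies the upper right block by P.\<close>

lemma unitarily_similar_four_block:
  assumes A1: "A1 \<in> carrier_mat n n" and A2: "A2 \<in> carrier_mat n m" and D: "D \<in> carrier_mat m m"
    and sim: "unitarily_similar D E"
  shows "\<exists>B2 \<in> carrier_mat n m. unitarily_similar (four_block_mat A1 A2 (0\<^sub>m m n) D) (four_block_mat A1 B2 (0\<^sub>m m n) E)"
proof -
  obtain P where P: "similar_mat_wit D E P (mat_adjoint P)" using sim unfolding unitarily_similar_def by blast
  note PD = similar_mat_witD2[OF D P]
  have "A2 * P * mat_adjoint P = A2"
    using assoc_mult_mat[OF A2 PD(6,7)] PD(1) A2 by simp
  then have 1: "A2 = 1\<^sub>m n * (A2 * P) * mat_adjoint P" using A2 PD(6) by simp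
  have 2: "0\<^sub>m m n = P * 0\<^sub>m m n * (1\<^sub>m n)" using PD(6) by simp
  have "similar_mat_wit (four_block_mat A1 A2 (0\<^sub>m m n) D) (four_block_mat A1 (A2 * P) (0\<^sub>m m n) E)
    (four_block_mat (1\<^sub>m n) (0\<^sub>m n m) (0\<^sub>m m n) P) (four_block_mat (1\<^sub>m n) (0\<^sub>m n m) (0\<^sub>m m n) (mat_adjoint P))"
    by (rule similar_mat_wit_four_block[OF similar_mat_wit_refl[OF A1] P 1 2 A1 D]) (use A2 PD(6) in auto)
  moreover have "four_block_mat (1\<^sub>m n) (0\<^sub>m n m) (0\<^sub>m m n) (mat_adjoint P)
     = mat_adjoint (four_block_mat (1\<^sub>m n) (0\<^sub>m n m) (0\<^sub>m m n) P)"
    by (rule eq_matI) (use PD(6) in auto)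
  moreover have "A2 * P \<in> carrier_mat n m" using A2 PD(6) by simp
  ultimately show ?thesis unfolding unitarily_similar_def by metis
qed

text \<open>Schur triangularization by deflation, taking a kernel vector while there is one. If
  \<open>det A = 0\<close>, the first diagonal entry is 0 and the order is inherited from the
  smaller block; otherwise no diagonal entry is 0 at all.\<close>

lemma unitary_triangularization_zeros_first:
  assumes "A \<in> carrier_mat n n"
  shows "\<exists>B. B \<in> carrier_mat n n \<and> unitarily_similar A B \<and> upper_triangular B \<and>
    (\<forall>i<n. B $$ (i, i) = 0 \<longrightarrow> (\<forall>j\<le>i. B $$ (j, j) = 0))"
  using assms
proof (induction n arbitrary: A)
  case 0
  then show ?case using unitarily_similar_refl[OF 0] by (intro exI[of _ A]) auto
next
  case (Suc n)
  obtain A' e where A': "A' \<in> carrier_mat (Suc n) (Suc n)" "unitarily_similar A A'"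
    and col: "\<forall>i<Suc n. A' $$ (i, 0) = (if i = 0 then e else 0)" and e: "det A = 0 \<longrightarrow> e = 0"
    using unitarily_similar_eigen_first[OF Suc.prems] by blast
  obtain A1 A2 A3 D where split: "split_block A' 1 1 = (A1, A2, A3, D)" by (metis prod_cases4)
  have "dim_row A' = 1 + n" "dim_col A' = 1 + n" using A'(1) by auto
  note sb = split_block[OF split this]
  have "A3 = 0\<^sub>m n 1"
  proof (rule eq_matI)
    fix i j assume ij: "i < dim_row (0\<^sub>m n 1 :: complex mat)" "j < dim_col (0\<^sub>m n 1 :: complex mat)"
    have "A' $$ (Suc i, 0) = A3 $$ (i, 0)"
      unfolding sb(5) using sb(1-4) ij by (subst index_mat_four_block) auto
    then show "A3 $$ (i, j) = 0\<^sub>m n 1 $$ (i, j)" using col ij by auto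
  qed (use sb in auto)
  then have A'_eq: "A' = four_block_mat A1 A2 (0\<^sub>m n 1) D" using sb(5) by simp
  have A1e: "A1 $$ (0, 0) = e"
  proof -
    have "A' $$ (0, 0) = A1 $$ (0, 0)"
      unfolding sb(5) using sb(1-4) by (subst index_mat_four_block) auto
    then show ?thesis using col by simp
  qed
  obtain E where E: "E \<in> carrier_mat n n" "unitarily_similar D E" "upper_triangular E"
    and EZ: "\<forall>i<n. E $$ (i, i) = 0 \<longrightarrow> (\<forall>j\<le>i. E $$ (j, j) = 0)"
    using Suc.IH[OF sb(4)] by blast
  obtain B2 where B2: "B2 \<in> carrier_mat 1 n"
    and simB: "unitarily_similar A' (four_block_mat A1 B2 (0\<^sub>m n 1) E)"
    using unitarily_similar_four_block[OF sb(1,2,4) E(2)] unfolding A'_eq by blast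
  define B where "B = four_block_mat A1 B2 (0\<^sub>m n 1) E"
  have B: "B \<in> carrier_mat (Suc n) (Suc n)" unfolding B_def using four_block_carrier_mat[OF sb(1) E(1)] by simp
  have sim: "unitarily_similar A B" using unitarily_similar_trans[OF A'(2) simB] unfolding B_def .
  have "upper_triangular A1" using sb(1) by auto
  then have up: "upper_triangular B" unfolding B_def by (rule upper_triangular_four_block[OF sb(1) E(1) _ E(3)])
  have diag: "B $$ (i, i) = (if i = 0 then e else E $$ (i - 1, i - 1))" if "i < Suc n" for i
    unfolding B_def using that sb(1) E(1) A1e by (subst index_mat_four_block) auto
  have "\<forall>i<Suc n. B $$ (i, i) = 0 \<longrightarrow> (\<forall>j\<le>i. B $$ (j, j) = 0)"
  proof (cases "det A = 0")
    case True
    then have e0: "e = 0" using e by simp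
    show ?thesis
    proof (intro allI impI)
      fix i j assume i: "i < Suc n" "B $$ (i, i) = 0" and j: "j \<le> i"
      show "B $$ (j, j) = 0"
      proof (cases "j = 0")
        case False
        then have "E $$ (i - 1, i - 1) = 0" "i - 1 < n" "j - 1 \<le> i - 1" using i j diag[OF i(1)] by auto
        then have "E $$ (j - 1, j - 1) = 0" using EZ by blast
        then show ?thesis using diag[of j] False i j by simp
      qed (use diag[of 0] e0 in simp)
    qed
  next
    case False
    have "similar_mat A B" using sim unfolding unitarily_similar_def similar_mat_def by blast
    then have "det B \<noteq> 0" using False det_similar by metis
    then have "0 \<notin> set (diag_mat B)" using det_upper_triangular[OF up B] by (simp add: prod_list_zero_iff)
    moreover have "B $$ (i, i) \<in> set (diag_mat B)" if "i < Suc n" for i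
      using that B by (auto simp: diag_mat_def simp del: upt_Suc)
    ultimately have "B $$ (i, i) \<noteq> 0" if "i < Suc n" for i using that by metis
    then show ?thesis by blast
  qed
  then show ?case using B sim up by blast
qed

text \<open>The same U serves for the defects, because U^* U cancels inside A^* A = U B^* U^* U B
  U^*.\<close>

lemma unitarily_similar_defect:
  assumes A: "A \<in> carrier_mat n n" and sim: "unitarily_similar A B"
  shows "unitarily_similar (1\<^sub>m n - mat_adjoint A * A) (1\<^sub>m n - mat_adjoint B * B)"
proof -
  obtain U where U: "similar_mat_wit A B U (mat_adjoint U)" using sim unfolding unitarily_similar_def by blast
  note D = similar_mat_witD2[OF A U]
  let ?U = "mat_adjoint U" and ?B = "mat_adjoint B"
  have cB: "?B \<in> carrier_mat n n" using D(5) by simp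
  note [simp] = assoc_mult_mat[of _ n n _ n _ n]
  have "mat_adjoint A = U * ?B * ?U"
    unfolding D(3) using D(5-7) cB by (simp add: mat_adjoint_mult[of _ n n _ n])
  then have "mat_adjoint A * A = U * ?B * (?U * U) * B * ?U"
    unfolding D(3) using D(5-7) cB by (simp del: mat_adjoint_carrier)
  also have "\<dots> = U * (?B * B) * ?U" unfolding D(2) using D(5-7) cB by (simp del: mat_adjoint_carrier)
  finally have "1\<^sub>m n - mat_adjoint A * A = U * ?U - U * (?B * B) * ?U" unfolding D(1) by simp
  also have "\<dots> = (U * 1\<^sub>m n - U * (?B * B)) * ?U"
    using D(5-7) cB by (subst minus_mult_distrib_mat[of _ n n _ _ n]) auto
  also have "\<dots> = U * (1\<^sub>m n - ?B * B) * ?U"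
    using D(5-7) cB by (subst mult_minus_distrib_mat[of _ n n _ n]) auto
  finally have "similar_mat_wit (1\<^sub>m n - mat_adjoint A * A) (1\<^sub>m n - ?B * B) U ?U"
    by (intro similar_mat_witI[OF D(1,2)]) (use D(4-7) cB A in auto)
  then show ?thesis unfolding unitarily_similar_def by blast
qed

subsection \<open>Discs force nilpotency\<close>

text \<open>Extracts what the argument uses from a disc: by homogeneity the bound extends from unit
  vectors to all vectors, and the radius is attained in every direction t.\<close>

lemma num_range_disc_bounds:
  assumes W: "num_range N M = cball 0 r" and r: "0 \<le> r"
  shows "cmod (ip N (app N M y) y) \<le> r * sq N y"
    and "cmod t = 1 \<Longrightarrow> \<exists>x. sq N x = 1 \<and> ip N (app N M x) x = of_real r * t"
proof -
  show "cmod (ip N (app N M y) y) \<le> r * sq N y"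
  proof (cases "sq N y = 0")
    case True
    then have "ip N (app N M y) y = 0" unfolding sq_eq_0_iff by (simp add: ip_def)
    then show ?thesis using True by simp
  next
    case False
    then have pos: "0 < sq N y" using sq_nonneg[of N y] by simp
    define c where "c = complex_of_real (1 / sqrt (sq N y))"
    have c2: "c * cnj c = of_real (1 / sq N y)"
      using pos by (simp add: c_def of_real_mult[symmetric] del: of_real_mult of_real_divide)
    have "sq N (\<lambda>i. c * y i) = 1" unfolding sq_scale c_def using pos by (simp add: norm_divide power_divide)
    then have "ip N (app N M (\<lambda>i. c * y i)) (\<lambda>i. c * y i) \<in> cball 0 r"
      unfolding W[symmetric] num_range_def by blast
    then have "cmod (of_real (1 / sq N y) * ip N (app N M y) y) \<le> r"
      unfolding app_scale ip_scale c2 by simp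
    then show ?thesis using pos by (simp add: norm_mult norm_divide field_simps)
  qed
  assume "cmod t = 1"
  then have "of_real r * t \<in> num_range N M" unfolding W using r by (simp add: norm_mult)
  then show "\<exists>x. sq N x = 1 \<and> ip N (app N M x) x = of_real r * t"
    unfolding num_range_def by force
qed

text \<open>For m = n the lemma \<open>superdiagonal\<close> leaves a weighted shift with unimodular
  weights, whose phases a diagonal unitary absorbs.\<close>

lemma (in nilpotent_first) unitarily_similar_jordan_block:
  assumes C: "C \<in> carrier_mat n n" and BC: "\<And>i j. i < n \<Longrightarrow> j < n \<Longrightarrow> C $$ (i, j) = B i j" and mn: "m = n"
  shows "unitarily_similar C (jordan_block n 0)"
proof -
  \<comment> \<open>The recursion solves \<open>d i * cnj (d (Suc i)) = B i (Suc i)\<close> for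
    unimodular d.\<close>
  define d where "d = rec_nat (1::complex) (\<lambda>i z. z * cnj (B i (Suc i)))"
  have d0: "d 0 = 1" and dS: "d (Suc i) = d i * cnj (B i (Suc i))" for i by (simp_all add: d_def)
  have d1: "cmod (d i) = 1" if "i < n" for i
    using that by (induction i) (use superdiagonal mn in \<open>auto simp: d0 dS norm_mult\<close>)
  have dd: "d i * cnj (d i) = 1" "cnj (d i) * d i = 1" if "i < n" for i
    using d1[OF that] by (simp_all add: complex_norm_square[symmetric] mult.commute[of "cnj _"])
  define D where "D = mat n n (\<lambda>(i, j). if i = j then d i else 0)"
  have D: "D \<in> carrier_mat n n" by (simp add: D_def)
  have adj: "mat_adjoint D = mat n n (\<lambda>(i, j). if i = j then cnj (d i) else 0)"
    by (rule eq_matI) (auto simp: D_def)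
  have sum1: "(\<Sum>k<n. (if i = k then f k else 0) * h k) = f i * h i"
    if "i < n" for i and f h :: "nat \<Rightarrow> complex"
  proof -
    have "(\<Sum>k<n. (if i = k then f k else 0) * h k) = (\<Sum>k<n. if k = i then f i * h i else 0)"
      by (rule sum.cong) auto
    then show ?thesis using that by simp
  qed
  have left: "(mat n n (\<lambda>(i, j). if i = j then f i else 0) * X) $$ (i, j) = f i * X $$ (i, j)"
    if "i < n" "j < n" "X \<in> carrier_mat n n" for i j X and f :: "nat \<Rightarrow> complex"
  proof -
    have "(mat n n (\<lambda>(i, j). if i = j then f i else 0) * X) $$ (i, j)
        = (\<Sum>k<n. (if i = k then f i else 0) * X $$ (k, j))"
      using that by (auto simp: scalar_prod_def atLeast0LessThan intro!: sum.cong)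
    also have "\<dots> = f i * X $$ (i, j)" using sum1[OF that(1), of "\<lambda>_. f i"] .
    finally show ?thesis .
  qed
  have right: "(X * mat n n (\<lambda>(i, j). if i = j then f i else 0)) $$ (i, j) = X $$ (i, j) * f j"
    if "i < n" "j < n" "X \<in> carrier_mat n n" for i j X and f :: "nat \<Rightarrow> complex"
  proof -
    have "(X * mat n n (\<lambda>(i, j). if i = j then f i else 0)) $$ (i, j)
        = (\<Sum>k<n. (if j = k then f k else 0) * X $$ (i, k))"
      using that by (auto simp: scalar_prod_def atLeast0LessThan mult.commute intro!: sum.cong)
    also have "\<dots> = f j * X $$ (i, j)" using sum1[OF that(2)] .
    finally show ?thesis by (simp add: mult.commute)
  qed
  have J: "jordan_block n 0 \<in> carrier_mat n n" by simp
  have DJ: "D * jordan_block n 0 \<in> carrier_mat n n" using D J by (meson mult_carrier_mat)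
  have C_eq: "C = D * jordan_block n 0 * mat_adjoint D"
  proof (rule eq_matI)
    fix i j assume "i < dim_row (D * jordan_block n 0 * mat_adjoint D)" "j < dim_col (D * jordan_block n 0 * mat_adjoint D)"
    then have ij: "i < n" "j < n" using D by auto
    have 1: "(D * jordan_block n 0 * mat_adjoint D) $$ (i, j) = d i * of_bool (Suc i = j) * cnj (d j)"
      unfolding adj right[OF ij DJ] unfolding D_def left[OF ij J] using ij by auto
    have "B i j = d i * of_bool (Suc i = j) * cnj (d j)"
    proof (cases "Suc i = j")
      case True
      then show ?thesis using dd[OF ij(1)] dS[of i] by (auto simp: mult.assoc[symmetric])
    next
      case False
      have "B i j = 0"
      proof (cases "Suc i < n")
        case True
        then show ?thesis using superdiagonal[of i] False ij mn by auto
      next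
        case ni: False
        then have "j \<le> i" using ij by simp
        then show ?thesis using tri[OF ij(1)] diag_0[of i] ij mn by (cases "j = i") auto
      qed
      then show ?thesis using False by simp
    qed
    then show "C $$ (i, j) = (D * jordan_block n 0 * mat_adjoint D) $$ (i, j)"
      unfolding 1 BC[OF ij] .
  qed (use C D in auto)
  have "D * mat_adjoint D = 1\<^sub>m n"
  proof (rule eq_matI)
    fix i j assume "i < dim_row (1\<^sub>m n :: complex mat)" "j < dim_col (1\<^sub>m n :: complex mat)"
    then have ij: "i < n" "j < n" by auto
    show "(D * mat_adjoint D) $$ (i, j) = 1\<^sub>m n $$ (i, j)"
      unfolding adj right[OF ij D] using ij dd by (auto simp: D_def)
  qed (use D in auto)
  moreover have "mat_adjoint D * D = 1\<^sub>m n"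
  proof (rule eq_matI)
    fix i j assume "i < dim_row (1\<^sub>m n :: complex mat)" "j < dim_col (1\<^sub>m n :: complex mat)"
    then have ij: "i < n" "j < n" by auto
    show "(mat_adjoint D * D) $$ (i, j) = 1\<^sub>m n $$ (i, j)"
      unfolding adj left[OF ij D] using ij dd by (auto simp: D_def)
  qed (use D in auto)
  ultimately have "similar_mat_wit C (jordan_block n 0) D (mat_adjoint D)"
    by (intro similar_mat_witI[OF _ _ C_eq C J D]) (use D in auto)
  then show ?thesis unfolding unitarily_similar_def by blast
qed

text \<open>The defect of B has entries \<open>\<alpha> i * \<beta> j\<close>. If m > 0, column 0 of
  B is zero, so row and column 0 of the defect are those of the identity. This forces
  \<open>\<alpha> 0 * \<beta> 0 = 1\<close> and all other factors to be 0, whence B^* B = diag(0, 1,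
  ..., 1).\<close>

lemma nilpotent_first_form:
  assumes A: "A \<in> carrier_mat n n" and rank: "vec_space.rank n (1\<^sub>m n - mat_adjoint A * A) = 1"
  shows "\<exists>B m. B \<in> carrier_mat n n \<and> unitarily_similar A B \<and> nilpotent_first n m (ent B)"
proof -
  obtain B where B: "B \<in> carrier_mat n n" and sim: "unitarily_similar A B" and up: "upper_triangular B"
    and zf: "\<forall>i<n. B $$ (i, i) = 0 \<longrightarrow> (\<forall>j\<le>i. B $$ (j, j) = 0)"
    using unitary_triangularization_zeros_first[OF A] by blast
  \<comment> \<open>The alternative \<open>i = n\<close> makes m = n when the whole diagonal is
    zero.\<close>
  define m where "m = (LEAST i. i = n \<or> B $$ (i, i) \<noteq> 0)"
  have m_prop: "m = n \<or> B $$ (m, m) \<noteq> 0" and m_le: "m \<le> n"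
    unfolding m_def by (rule LeastI[of _ n], simp) (rule Least_le, simp)
  have below: "B $$ (i, i) = 0" if "i < m" for i
    using not_less_Least[of i "\<lambda>i. i = n \<or> B $$ (i, i) \<noteq> 0"] that unfolding m_def by simp
  have above: "B $$ (i, i) \<noteq> 0" if "m \<le> i" "i < n" for i
    using zf m_prop that by auto
  have tri: "B $$ (i, j) = 0" if "i < n" "j < i" for i j
    using up that B by auto
  let ?R = "\<lambda>A. 1\<^sub>m n - mat_adjoint A * A"
  have R: "?R A \<in> carrier_mat n n" "?R B \<in> carrier_mat n n" using A B by auto
  obtain a b where ab: "\<forall>i<n. \<forall>j<n. ?R A $$ (i, j) = a i * b j"
    using rank_one_product_entries[OF R(1) rank] by blast
  have "unitarily_similar (?R B) (?R A)"
    using unitarily_similar_sym[OF unitarily_similar_defect[OF A sim]] .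
  from unitarily_similar_entries[OF this R(2)] obtain U where
    U: "\<forall>i<n. \<forall>j<n. ent (?R B) i j = (\<Sum>k<n. \<Sum>l<n. U i k * ent (?R A) k l * cnj (U j l))" by blast
  \<comment> \<open>Conjugation by U turns the product of a and b into the product of U a and the
    row b U^*.\<close>
  define \<alpha> where "\<alpha> i = (\<Sum>k<n. U i k * a k)" for i
  define \<beta> where "\<beta> j = (\<Sum>l<n. b l * cnj (U j l))" for j
  have RB: "of_bool (i = j) - (\<Sum>k<n. cnj (ent B k i) * ent B k j) = \<alpha> i * \<beta> j" if ij: "i < n" "j < n" for i j
  proof -
    have "ent (?R B) i j = (\<Sum>k<n. \<Sum>l<n. U i k * (a k * b l) * cnj (U j l))"
      using U ij ab by (simp add: ent_def)
    also have "\<dots> = \<alpha> i * \<beta> j" unfolding \<alpha>_def \<beta>_def sum_product by (simp add: mult_ac)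
    finally have "ent (?R B) i j = \<alpha> i * \<beta> j" .
    moreover have "ent (?R B) i j = of_bool (i = j) - (\<Sum>k<n. cnj (ent B k i) * ent B k j)"
      using B ij by (auto simp: ent_def scalar_prod_def atLeast0LessThan intro!: sum.cong)
    ultimately show ?thesis by simp
  qed
  have "nilpotent_first n m (ent B)"
  proof
    fix j k assume m: "0 < m" and j: "j < n" and k: "k < n"
    have n: "0 < n" using j by simp
    have col0: "ent B i 0 = 0" if "i < n" for i
      using below[OF m] tri[OF that, of 0] by (cases "i = 0") (auto simp: ent_def)
    have 00: "\<alpha> 0 * \<beta> 0 = 1" using RB[OF n n] col0 by simp
    have "\<alpha> i = 0" if "i < n" "i \<noteq> 0" for i using RB[OF that(1) n] col0 00 that by auto
    moreover have "\<beta> i = 0" if "i < n" "i \<noteq> 0" for i using RB[OF n that(1)] col0 00 that by auto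
    ultimately have "\<alpha> j * \<beta> k = of_bool (j = 0 \<and> k = 0)" using j k 00 by auto
    then have "(\<Sum>i<n. cnj (ent B i j) * ent B i k) = of_bool (j = k) - of_bool (j = 0 \<and> k = 0)"
      using RB[OF j k] by (simp add: algebra_simps)
    then show "(\<Sum>i<n. cnj (ent B i j) * ent B i k) = (if j = k then of_bool (0 < j) else 0)" by auto
  qed (use m_le tri below above in \<open>auto simp: ent_def\<close>)
  then show ?thesis using B sim by blast
qed

theorem theorem3p3:
  fixes n :: nat and A :: "complex mat"
  assumes "S_matrix n A"
  shows "(origin_disc (numerical_range A) \<longleftrightarrow> origin_disc (numerical_range (kronecker_mat A A))) \<and>
         (origin_disc (numerical_range (kronecker_mat A A)) \<longleftrightarrow> unitarily_similar A (jordan_block n 0))"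
proof -
  have A: "A \<in> carrier_mat n n" and rank: "vec_space.rank n (1\<^sub>m n - mat_adjoint A * A) = 1"
    using assms unfolding S_matrix_def by auto
  \<comment> \<open>The rank is at most the number of columns, so it could not be 1 for n =
    0.\<close>
  have n: "0 < n"
  proof (rule ccontr)
    assume "\<not> 0 < n"
    moreover have "1\<^sub>m n - mat_adjoint A * A \<in> carrier_mat n n" using A by auto
    ultimately show False using vec_space.rank_le_nc rank by force
  qed
  obtain B m where B: "B \<in> carrier_mat n n" and sim: "unitarily_similar A B" and form: "nilpotent_first n m (ent B)"
    using nilpotent_first_form[OF A rank] by blast
  interpret nilpotent_first n m "ent B" by (rule form)
  have nilpotent: "unitarily_similar A (jordan_block n 0)" if "m = n"
    using unitarily_similar_trans[OF sim unitarily_similar_jordan_block[OF B _ that]] by (simp add: ent_def)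
  have a_c: "unitarily_similar A (jordan_block n 0)" if "origin_disc (numerical_range A)"
  proof -
    obtain r where r: "0 \<le> r" "num_range n (ent B) = cball 0 r"
      using \<open>origin_disc _\<close> unfolding origin_disc_def unitarily_similar_numerical_range(1)[OF A sim] by blast
    show ?thesis
      by (intro nilpotent disc_imp_nilpotent[of r] num_range_disc_bounds[OF r(2,1)])
  qed
  have b_c: "unitarily_similar A (jordan_block n 0)" if "origin_disc (numerical_range (kronecker_mat A A))"
  proof -
    obtain r where r: "0 \<le> r" "num_range (n*n) (kron n (ent B)) = cball 0 r"
      using \<open>origin_disc _\<close> unfolding origin_disc_def unitarily_similar_numerical_range(2)[OF A sim] by blast
    show ?thesis
      by (intro nilpotent kron_disc_imp_nilpotent[of r] num_range_disc_bounds[OF r(2,1)])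
  qed
  have c_ab: "origin_disc (numerical_range A) \<and> origin_disc (numerical_range (kronecker_mat A A))"
    if J: "unitarily_similar A (jordan_block n 0)"
  proof -
    have J_eq: "ent (jordan_block n 0) i j = shift i j" if "i < n" "j < n" for i j
      using that by (auto simp: ent_def shift_def)
    have "num_range n (ent (jordan_block n 0)) = num_range n shift"
      using J_eq by (rule num_range_cong)
    moreover have "num_range (n*n) (kron n (ent (jordan_block n 0))) = num_range (n*n) (kron n shift)"
      by (rule num_range_cong) (simp add: kron_def J_eq div_mod_less)
    \<comment> \<open>Since n is at least 1, the angle is at most pi/2; for n = 1 the disc
      degenerates to the point 0.\<close>
    moreover have "0 \<le> cos (pi / real (n + 1))"
      using n by (intro cos_ge_zero) (auto simp: field_simps)
    ultimately show ?thesis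
      unfolding origin_disc_def unitarily_similar_numerical_range[OF A J] using num_range_shift[OF n] by auto
  qed
  show ?thesis using a_c b_c c_ab by blast
qed

end
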